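(* Let $X$ be a generic $n\times m$ generalized diagonal matrix over a field $k$, let $R=k[X]$ with the lexicographic monomial order described in the context, and let $r\ge 1$. Then the $r\times r$ minors of $X$ form a Gröbner basis for the ideal $I_r(X)\subset R$ which they generate.
   Context: A generalized diagonal (GD) matrix is an $n\times m$ matrix with two ladders of zeros, $L_1$ (bottom left) and $L_2$ (top right), described as follows. Given positive integers $c_1\ge c_2\ge\dots\ge c_s$ with $s<m$ and $c_1<n$, $L_1$ consists of the last $c_i$ entries of column $i$, for $i=1,\dots,s$. Given positive integers $d_t\le d_{t+1}\le\dots\le d_m$ with $t>1$ and $d_m<n$, $L_2$ consists of the first $d_i$ entries of column $i$, for $i=t,\dots,m$. Either ladder may be empty. The matrix is generic if its entries outside $L_1\cup L_2$ are distinct indeterminates $x_{ij}$ over a field $k$ (with $x_{ij}$ in row $i$ and column $j$), and the entries in $L_1\cup L_2$ are $0$. $R=k[X]$ is the polynomial ring over $k$ in the non-zero entries of $X$. The variables are ordered by $x_{ij}>x_{kl}$ if $i<k$, or $i=k$ and $j<l$, and this is extended to the lexicographic order on monomials of $R$. $I_r(X)$ is the ideal of $R$ generated by the $r\times r$ minors of $X$. (Minors which are zero are allowed and contribute nothing.) *)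

theory Defs
  imports
    "HOL-Library.Poly_Mapping"
    "HOL-Library.Product_Lexorder"
    "HOL-Algebra.Ideal"
    "Jordan_Normal_Form.Determinant"
    "Jordan_Normal_Form.DL_Submatrix"
begin

text \<open>The pair \<open>(i, j)\<close> stands for the indeterminate \<open>x\<^sub>i\<^sub>j\<close> (rows and columns counted from 1);
  a monomial is its exponent function.\<close>

type_synonym monomial = "nat \<times> nat \<Rightarrow>\<^sub>0 nat"
type_synonym 'k mpoly = "monomial \<Rightarrow>\<^sub>0 'k"

definition mono_poly :: "monomial \<Rightarrow> 'k::field mpoly" where
  "mono_poly u = Poly_Mapping.single u 1"

definition indet :: "nat \<times> nat \<Rightarrow> 'k::field mpoly" where
  "indet v = mono_poly (Poly_Mapping.single v 1)"

definition poly_ring :: "(nat \<times> nat) set \<Rightarrow> 'k::field mpoly ring" where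
  "poly_ring V = \<lparr>carrier = {p. \<forall>u \<in> Poly_Mapping.keys p. Poly_Mapping.keys u \<subseteq> V},
     monoid.mult = (*), one = 1, zero = 0, add = (+)\<rparr>"

text \<open>The library order on monomials compares exponents at the smallest index where they differ,
  indices being ordered lexicographically. Thus the indeterminate with the smallest index is the
  largest one, and \<open><\<close> is the lexicographic monomial order extending
  \<open>x\<^sub>i\<^sub>j > x\<^sub>k\<^sub>l \<longleftrightarrow> i < k \<or> (i = k \<and> j < l)\<close>.\<close>

lemma monomial_less_iff:
  fixes u w :: monomial
  shows "u < w \<longleftrightarrow>
    (\<exists>k l. Poly_Mapping.lookup u (k, l) < Poly_Mapping.lookup w (k, l) \<and>
      (\<forall>i j. i < k \<or> i = k \<and> j < l \<longrightarrow>
        Poly_Mapping.lookup u (i, j) = Poly_Mapping.lookup w (i, j)))"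
proof -
  have "(i, j) < (k, l) \<longleftrightarrow> i < k \<or> i = k \<and> j < l" for i j k l :: nat
    by auto
  then show ?thesis
    by (simp only: less_poly_mapping.rep_eq less_fun_def split_paired_Ex split_paired_All)
qed

lemma indet_order:
  "(Poly_Mapping.single (k, l) 1 :: monomial) < Poly_Mapping.single (i, j) 1
     \<longleftrightarrow> i < k \<or> i = k \<and> j < l" (is "?u < ?w \<longleftrightarrow> _")
proof -
  have gt: "Poly_Mapping.single b 1 < (Poly_Mapping.single a 1 :: monomial)"
    if "a < b" for a b :: "nat \<times> nat"
    unfolding less_poly_mapping.rep_eq less_fun_def
    by (rule exI[of _ a]) (use that in \<open>auto simp: lookup_single when_def\<close>)
  have "?u < ?w \<longleftrightarrow> (i, j) < (k, l)"
  proof (cases "(i, j)" "(k, l)" rule: linorder_cases)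
    case less
    then show ?thesis using gt[OF less] by blast
  next
    case equal
    then show ?thesis by simp
  next
    case greater
    then show ?thesis using gt[OF greater] by (meson order_less_asym)
  qed
  then show ?thesis by auto
qed

text \<open>Only meaningful for nonzero polynomials.\<close>

definition lead_monom :: "'k::field mpoly \<Rightarrow> monomial" where
  "lead_monom p = Max (Poly_Mapping.keys p)"

definition initial_ideal :: "(nat \<times> nat) set \<Rightarrow> 'k::field mpoly set \<Rightarrow> 'k mpoly set" where
  "initial_ideal V F = Idl\<^bsub>poly_ring V\<^esub> {mono_poly (lead_monom f) | f. f \<in> F \<and> f \<noteq> 0}"

definition groebner_basis :: "(nat \<times> nat) set \<Rightarrow> 'k::field mpoly set \<Rightarrow> 'k mpoly set \<Rightarrow> bool" where
  "groebner_basis V G I \<longleftrightarrow> finite G \<and> G \<subseteq> I \<and> initial_ideal V G = initial_ideal V I"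

text \<open>Empty ladders are given by \<open>s = 0\<close> and \<open>t = m + 1\<close>, respectively.\<close>

definition gd_shape :: "nat \<Rightarrow> nat \<Rightarrow> nat \<Rightarrow> (nat \<Rightarrow> nat) \<Rightarrow> nat \<Rightarrow> (nat \<Rightarrow> nat) \<Rightarrow> bool" where
  "gd_shape n m s c t d \<longleftrightarrow>
     s < m \<and> (\<forall>i\<in>{1..s}. 0 < c i \<and> c i < n) \<and> (\<forall>i\<in>{1..s}. \<forall>j\<in>{1..s}. i \<le> j \<longrightarrow> c j \<le> c i) \<and>
     1 < t \<and> t \<le> m + 1 \<and>
     (\<forall>i\<in>{t..m}. 0 < d i \<and> d i < n) \<and> (\<forall>i\<in>{t..m}. \<forall>j\<in>{t..m}. i \<le> j \<longrightarrow> d i \<le> d j)"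

definition lower_ladder :: "nat \<Rightarrow> nat \<Rightarrow> (nat \<Rightarrow> nat) \<Rightarrow> (nat \<times> nat) set" where
  "lower_ladder n s c = {(i, j). 1 \<le> j \<and> j \<le> s \<and> n - c j < i \<and> i \<le> n}"

definition upper_ladder :: "nat \<Rightarrow> nat \<Rightarrow> (nat \<Rightarrow> nat) \<Rightarrow> (nat \<times> nat) set" where
  "upper_ladder m t d = {(i, j). t \<le> j \<and> j \<le> m \<and> 1 \<le> i \<and> i \<le> d j}"

definition gd_vars ::
  "nat \<Rightarrow> nat \<Rightarrow> nat \<Rightarrow> (nat \<Rightarrow> nat) \<Rightarrow> nat \<Rightarrow> (nat \<Rightarrow> nat) \<Rightarrow> (nat \<times> nat) set" where
  "gd_vars n m s c t d = ({1..n} \<times> {1..m}) - (lower_ladder n s c \<union> upper_ladder m t d)"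

text \<open>Matrix entries are indexed from 0, hence the shift.\<close>

definition gd_matrix ::
  "nat \<Rightarrow> nat \<Rightarrow> nat \<Rightarrow> (nat \<Rightarrow> nat) \<Rightarrow> nat \<Rightarrow> (nat \<Rightarrow> nat) \<Rightarrow> 'k::field mpoly mat" where
  "gd_matrix n m s c t d = mat n m (\<lambda>(i, j).
     if (i + 1, j + 1) \<in> lower_ladder n s c \<union> upper_ladder m t d then 0 else indet (i + 1, j + 1))"

definition minors :: "nat \<Rightarrow> 'a::comm_ring_1 mat \<Rightarrow> 'a set" where
  "minors r A = {det (submatrix A I J) | I J.
     I \<subseteq> {..<dim_row A} \<and> J \<subseteq> {..<dim_col A} \<and> card I = r \<and> card J = r}"

definition minor_ideal :: "(nat \<times> nat) set \<Rightarrow> nat \<Rightarrow> 'k::field mpoly mat \<Rightarrow> 'k mpoly set" where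
  "minor_ideal V r A = Idl\<^bsub>poly_ring V\<^esub> (minors r A)"

lemma cring_poly_ring: "cring (poly_ring V :: 'k::field mpoly ring)"
proof -
  have add: "p + q \<in> carrier (poly_ring V)"
    if "p \<in> carrier (poly_ring V)" "q \<in> carrier (poly_ring V)" for p q :: "'k mpoly"
    using that Poly_Mapping.keys_add[of p q] by (auto simp: poly_ring_def)
  have mult: "p * q \<in> carrier (poly_ring V)"
    if p: "p \<in> carrier (poly_ring V)" and q: "q \<in> carrier (poly_ring V)" for p q :: "'k mpoly"
  proof -
    have "Poly_Mapping.keys u \<subseteq> V" if u: "u \<in> Poly_Mapping.keys (p * q)" for u
    proof -
      obtain a b where "u = a + b" "a \<in> Poly_Mapping.keys p" "b \<in> Poly_Mapping.keys q"
        using subsetD[OF keys_mult u] by auto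
      moreover from this p q have "Poly_Mapping.keys a \<subseteq> V" "Poly_Mapping.keys b \<subseteq> V"
        by (simp_all add: poly_ring_def)
      ultimately show ?thesis
        using Poly_Mapping.keys_add[of a b] by (metis Un_least subset_trans)
    qed
    then show ?thesis by (simp add: poly_ring_def)
  qed
  have minus: "- p \<in> carrier (poly_ring V)" if "p \<in> carrier (poly_ring V)" for p :: "'k mpoly"
    using that by (auto simp: poly_ring_def)
  have zero: "0 \<in> carrier (poly_ring V :: 'k mpoly ring)"
    and one: "1 \<in> carrier (poly_ring V :: 'k mpoly ring)"
    by (simp_all add: poly_ring_def)
  have sel: "x \<otimes>\<^bsub>poly_ring V\<^esub> y = x * y" "\<one>\<^bsub>poly_ring V\<^esub> = (1 :: 'k mpoly)"
    "x \<oplus>\<^bsub>poly_ring V\<^esub> y = x + y" "\<zero>\<^bsub>poly_ring V\<^esub> = (0 :: 'k mpoly)"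
    for x y :: "'k mpoly"
    by (simp_all add: poly_ring_def)
  have inv: "\<exists>q\<in>carrier (poly_ring V). q + p = 0"
    if "p \<in> carrier (poly_ring V)" for p :: "'k mpoly"
    using minus[OF that] by (intro bexI[of _ "- p"]) simp_all
  show ?thesis
  proof (rule cringI)
    show "abelian_group (poly_ring V :: 'k mpoly ring)"
      by (rule abelian_groupI; unfold sel) (assumption | rule add zero inv add.assoc add.commute add_0)+
    show "comm_monoid (poly_ring V :: 'k mpoly ring)"
      by (rule comm_monoidI; unfold sel) (assumption | rule mult one mult.assoc mult.commute mult_1)+
  qed (unfold sel, rule distrib_right)
qed

end

theory Submission
  imports Defs "HOL-Computational_Algebra.Formal_Laurent_Series"
begin

text \<open>A chain is a sequence of positions \<open>(i\<^sub>1, j\<^sub>1), \<dots>, (i\<^sub>r, j\<^sub>r)\<close> with strictly increasing rows and strictly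
  increasing columns. The lexicographic order picks the diagonal of a generic minor as its leading
  monomial, so the leading monomials of generic \<open>r\<close>-minors are exactly the products over \<open>r\<close>-chains. The
  ladders do not spoil this: if a diagonal meets a ladder, every term of the minor does, and the minor
  is zero (\<open>diagonal_zero_imp_term_zero\<close>); if it does not, setting the ladder variables to zero keeps the
  diagonal term. Hence the claim amounts to this: the support of the leading monomial of a nonzero
  element of the ideal of minors contains an \<open>r\<close>-chain.

  For a generic matrix this holds for every nonzero polynomial that vanishes at all matrices of rank
  less than \<open>r\<close> over some infinite extension field (\<open>lead_monom_has_chain\<close>). Such matrices are the
  products \<open>A B\<close> with inner dimension \<open>r - 1\<close>. One reads the variables in decreasing order and keeps only
  the coefficient of the leading power of each variable. Sending a variable to infinity while the matrix
  keeps rank less than \<open>r\<close> degenerates the set of products into a set of products whose second factor is cut off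
  along a staircase, and the remaining coefficient vanishes there (\<open>slice_at_step\<close>). The steps of the staircase
  move exactly as the chain ends in patience sorting of the support of the leading monomial. Without an
  \<open>r\<close>-chain there is always a step to move, until all variables are used up and the leading
  coefficient itself would have to be zero.

  The case with ladders is reduced to the generic one (\<open>gd_lead_has_chain\<close>). An element of the ideal of minors
  lifts to a polynomial that, like the generic minors, vanishes at low rank. Rewriting with generic minors (\<open>straighten\<close>) removes all
  monomials with \<open>r\<close>-chains. A monomial with a ladder variable is rewritten into such monomials only,
  so it never interferes with a leading monomial that has no chain and no ladder variable.\<close>

section \<open>Evaluation of polynomials\<close>

definition monom_at :: "(nat \<times> nat \<Rightarrow> 'a::comm_ring_1) \<Rightarrow> monomial \<Rightarrow> 'a" where
  "monom_at p w = (\<Prod>x\<in>Poly_Mapping.keys w. p x ^ Poly_Mapping.lookup w x)"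

text \<open>The coefficients are pushed along a ring homomorphism \<open>h\<close>, so that a polynomial over a finite field
  can be evaluated at points of an infinite extension, and, with \<open>h\<close> the embedding of constants, also
  at polynomials, which turns substitutions into evaluations.\<close>

definition poly_at ::
  "('k::field \<Rightarrow> 'a::comm_ring_1) \<Rightarrow> (nat \<times> nat \<Rightarrow> 'a) \<Rightarrow> 'k mpoly \<Rightarrow> 'a" where
  "poly_at h p f = (\<Sum>w\<in>Poly_Mapping.keys f. h (Poly_Mapping.lookup f w) * monom_at p w)"

lemma monom_at_superset:
  assumes "finite V" "Poly_Mapping.keys w \<subseteq> V"
  shows "monom_at p w = (\<Prod>x\<in>V. p x ^ Poly_Mapping.lookup w x)"
  unfolding monom_at_def
  by (rule prod.mono_neutral_left) (use assms in \<open>auto simp: in_keys_iff\<close>)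

lemma keys_monomial_add:
  "Poly_Mapping.keys (u + w :: monomial) = Poly_Mapping.keys u \<union> Poly_Mapping.keys w"
  by (auto simp: in_keys_iff lookup_add)

lemma monom_at_add: "monom_at p (u + w) = monom_at p u * monom_at p w"
proof -
  let ?V = "Poly_Mapping.keys u \<union> Poly_Mapping.keys w"
  have "finite ?V" by simp
  then show ?thesis
    using monom_at_superset[of ?V "u + w" p] monom_at_superset[of ?V u p] monom_at_superset[of ?V w p]
    by (simp add: keys_monomial_add lookup_add power_add prod.distrib)
qed

lemma poly_mapping_eq_sum_single:
  "f = (\<Sum>w\<in>Poly_Mapping.keys f. Poly_Mapping.single w (Poly_Mapping.lookup f w))"
  for f :: "'a \<Rightarrow>\<^sub>0 'b::comm_monoid_add"
  by (rule poly_mapping_eqI) (simp add: lookup_sum lookup_single when_def in_keys_iff)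

context
  fixes h :: "'k::field \<Rightarrow> 'a::comm_ring_1"
  assumes h: "comm_ring_hom h"
begin

interpretation h: comm_ring_hom h by (rule h)

lemma poly_at_superset:
  assumes "finite W" "Poly_Mapping.keys f \<subseteq> W"
  shows "poly_at h p f = (\<Sum>w\<in>W. h (Poly_Mapping.lookup f w) * monom_at p w)"
  unfolding poly_at_def
  by (rule sum.mono_neutral_left) (use assms in \<open>auto simp: in_keys_iff\<close>)

lemma poly_at_add: "poly_at h p (f + g) = poly_at h p f + poly_at h p g"
proof -
  let ?W = "Poly_Mapping.keys f \<union> Poly_Mapping.keys g"
  have "finite ?W" by simp
  then show ?thesis
    using poly_at_superset[of ?W] Poly_Mapping.keys_add[of f g]
    by (simp add: lookup_add h.hom_add sum.distrib distrib_right)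
qed

lemma poly_at_single: "poly_at h p (Poly_Mapping.single w c) = h c * monom_at p w"
  by (simp add: poly_at_def)

lemma poly_at_zero: "poly_at h p 0 = 0"
  by (simp add: poly_at_def)

lemma poly_at_sum: "poly_at h p (sum F S) = (\<Sum>i\<in>S. poly_at h p (F i))"
  by (induction S rule: infinite_finite_induct) (simp_all add: poly_at_zero poly_at_add)

lemma poly_at_mult: "poly_at h p (f * g) = poly_at h p f * poly_at h p g"
proof -
  let ?s = "\<lambda>f w. Poly_Mapping.single w (Poly_Mapping.lookup f w) :: 'k mpoly"
  have "f * g = (\<Sum>u\<in>Poly_Mapping.keys f. \<Sum>w\<in>Poly_Mapping.keys g. ?s f u * ?s g w)"
    by (subst (1) poly_mapping_eq_sum_single[of f], subst (1) poly_mapping_eq_sum_single[of g]) (rule sum_product)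
  then have "poly_at h p (f * g) =
      (\<Sum>u\<in>Poly_Mapping.keys f. \<Sum>w\<in>Poly_Mapping.keys g. poly_at h p (?s f u * ?s g w))"
    by (simp add: poly_at_sum)
  also have "\<dots> = (\<Sum>u\<in>Poly_Mapping.keys f. \<Sum>w\<in>Poly_Mapping.keys g.
      poly_at h p (?s f u) * poly_at h p (?s g w))"
    by (simp add: mult_single poly_at_single monom_at_add h.hom_mult mult_ac)
  also have "\<dots> = poly_at h p f * poly_at h p g"
    unfolding sum_product[symmetric] by (simp only: poly_at_single poly_at_def[of h p f] poly_at_def[of h p g])
  finally show ?thesis .
qed

lemma poly_at_hom: "comm_ring_hom (poly_at h p)"
  by unfold_locales
     (simp_all add: poly_at_add poly_at_mult poly_at_zero poly_at_single monom_at_def flip: single_one)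

lemma poly_at_indet: "poly_at h p (indet v) = p v"
  by (simp add: indet_def mono_poly_def poly_at_single monom_at_def)

end

section \<open>Generic minors and their leading monomials\<close>

definition perm_monom :: "nat \<Rightarrow> (nat \<Rightarrow> nat) \<Rightarrow> (nat \<Rightarrow> nat) \<Rightarrow> (nat \<Rightarrow> nat) \<Rightarrow> monomial" where
  "perm_monom r R C \<sigma> = (\<Sum>a = 0..<r. Poly_Mapping.single (R a, C (\<sigma> a)) 1)"

definition gen_minor :: "nat \<Rightarrow> (nat \<Rightarrow> nat) \<Rightarrow> (nat \<Rightarrow> nat) \<Rightarrow> 'k::field mpoly" where
  "gen_minor r R C = det (mat r r (\<lambda>(a, b). indet (R a, C b)))"

lemma mono_poly_zero: "mono_poly 0 = 1"
  by (simp add: mono_poly_def)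

lemma mono_poly_add: "mono_poly (u + w) = mono_poly u * mono_poly w"
  by (simp add: mono_poly_def mult_single)

lemma mono_poly_sum: "finite S \<Longrightarrow> mono_poly (sum g S) = (\<Prod>x\<in>S. mono_poly (g x))"
  by (induction S rule: finite_induct) (simp_all add: mono_poly_zero mono_poly_add)

lemma gen_minor_expand:
  "(gen_minor r R C :: 'k::field mpoly) = (\<Sum>\<sigma> | \<sigma> permutes {0..<r}.
     Poly_Mapping.single (perm_monom r R C \<sigma>) (of_int (sign \<sigma>)))"
proof -
  have "(gen_minor r R C :: 'k mpoly) = (\<Sum>\<sigma> | \<sigma> permutes {0..<r}.
      of_int (sign \<sigma>) * (\<Prod>a = 0..<r. mat r r (\<lambda>(a, b). indet (R a, C b)) $$ (a, \<sigma> a)))"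
    unfolding gen_minor_def by (rule det_def') simp
  also have "\<dots> = (\<Sum>\<sigma> | \<sigma> permutes {0..<r}.
      Poly_Mapping.single (perm_monom r R C \<sigma>) (of_int (sign \<sigma>)))"
  proof (rule sum.cong)
    fix \<sigma> assume "\<sigma> \<in> {\<sigma>. \<sigma> permutes {0..<r}}"
    then have "(\<Prod>a = 0..<r. mat r r (\<lambda>(a, b). indet (R a, C b) :: 'k mpoly) $$ (a, \<sigma> a))
        = (\<Prod>a = 0..<r. indet (R a, C (\<sigma> a)))"
      using permutes_in_image[of \<sigma> "{0..<r}"] by (intro prod.cong) auto
    then show "of_int (sign \<sigma>) * (\<Prod>a = 0..<r. mat r r (\<lambda>(a, b). indet (R a, C b) :: 'k mpoly) $$ (a, \<sigma> a))
        = Poly_Mapping.single (perm_monom r R C \<sigma>) (of_int (sign \<sigma>))"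
      by (simp add: indet_def perm_monom_def mono_poly_def mono_poly_sum[symmetric, unfolded mono_poly_def] mult_single flip: single_of_int)
  qed simp
  finally show ?thesis .
qed

lemma keys_perm_monom:
  "Poly_Mapping.keys (perm_monom r R C \<sigma>) = (\<lambda>a. (R a, C (\<sigma> a))) ` {0..<r}"
proof -
  have "x \<in> Poly_Mapping.keys (perm_monom r R C \<sigma>) \<longleftrightarrow> (\<exists>a\<in>{0..<r}. (R a, C (\<sigma> a)) = x)" for x
    by (simp add: perm_monom_def in_keys_iff lookup_sum lookup_single when_def)
  then show ?thesis by auto
qed

definition is_chain :: "nat \<Rightarrow> (nat \<Rightarrow> nat) \<Rightarrow> (nat \<Rightarrow> nat) \<Rightarrow> bool" where
  "is_chain r R C \<longleftrightarrow> strict_mono_on {0..<r} R \<and> strict_mono_on {0..<r} C"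

lemma lookup_perm_monom:
  assumes "inj_on R {0..<r}" "a < r"
  shows "Poly_Mapping.lookup (perm_monom r R C \<sigma>) (R a, y) = (if C (\<sigma> a) = y then 1 else 0)"
proof -
  have "Poly_Mapping.lookup (perm_monom r R C \<sigma>) (R a, y)
      = (\<Sum>b = 0..<r. if b = a then if C (\<sigma> a) = y then 1 else 0 else 0)"
    unfolding perm_monom_def lookup_sum lookup_single when_def
    by (rule sum.cong) (use assms in \<open>auto dest: inj_onD\<close>)
  then show ?thesis using assms by simp
qed

text \<open>At the first row \<open>a\<close> with \<open>\<sigma> a \<noteq> a\<close> the permutation must move to the right, because the smaller
  columns are taken. So the diagonal monomial has the larger exponent at \<open>(R a, C a)\<close>, and the two
  monomials agree at every earlier index.\<close>

lemma perm_monom_less: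
  assumes ch: "is_chain r R C" and \<sigma>: "\<sigma> permutes {0..<r}" "\<sigma> \<noteq> id"
  shows "perm_monom r R C \<sigma> < perm_monom r R C id"
proof -
  have R: "strict_mono_on {0..<r} R" and C: "strict_mono_on {0..<r} C"
    using ch by (auto simp: is_chain_def)
  have injR: "inj_on R {0..<r}" using R by (rule strict_mono_on_imp_inj_on)
  obtain a0 where "\<sigma> a0 \<noteq> a0" using \<sigma>(2) by (metis ext id_apply)
  define a where "a = (LEAST a. \<sigma> a \<noteq> a)"
  have a: "\<sigma> a \<noteq> a" unfolding a_def by (rule LeastI, rule \<open>\<sigma> a0 \<noteq> a0\<close>)
  have below: "\<sigma> b = b" if "b < a" for b using not_less_Least[of b] that by (auto simp: a_def)
  have ar: "a < r" using a \<sigma>(1) by (metis atLeastLessThan_iff le0 permutes_def)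
  have sr: "\<sigma> a < r" using ar permutes_in_image[OF \<sigma>(1), of a] by simp
  have sa: "a < \<sigma> a"
  proof (rule ccontr)
    assume "\<not> a < \<sigma> a"
    then have "\<sigma> a < a" using a by simp
    from below[OF this] show False using a permutes_inj[OF \<sigma>(1)] by (meson injD)
  qed
  have lt: "Poly_Mapping.lookup (perm_monom r R C \<sigma>) (R a, C a)
      < Poly_Mapping.lookup (perm_monom r R C id) (R a, C a)"
    using strict_mono_onD[OF C, of a "\<sigma> a"] sa sr ar by (simp add: lookup_perm_monom[OF injR])
  have eq: "Poly_Mapping.lookup (perm_monom r R C \<sigma>) (x, y)
      = Poly_Mapping.lookup (perm_monom r R C id) (x, y)"
    if xy: "x < R a \<or> x = R a \<and> y < C a" for x y
  proof (cases "x \<in> R ` {0..<r}")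
    case True
    then obtain b where b: "x = R b" "b < r" by auto
    have "b \<le> a" using xy b ar strict_mono_onD[OF R, of a b] by (metis atLeastLessThan_iff le0 not_less not_less_iff_gr_or_eq)
    show ?thesis
    proof (cases "b = a")
      case True
      then have "y < C a" using xy b by auto
      moreover have "C a < C (\<sigma> a)" using strict_mono_onD[OF C, of a "\<sigma> a"] sa sr ar by simp
      ultimately show ?thesis using b True by (simp add: lookup_perm_monom[OF injR])
    next
      case False
      then show ?thesis using below[of b] \<open>b \<le> a\<close> b by (simp add: lookup_perm_monom[OF injR])
    qed
  next
    case False
    then have "(x, y) \<notin> Poly_Mapping.keys (perm_monom r R C \<tau>)" for \<tau>
      by (auto simp: keys_perm_monom)
    then show ?thesis by (simp add: in_keys_iff)
  qed
  show ?thesis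
    unfolding monomial_less_iff using lt eq by blast
qed

lemma gen_minor_lead:
  assumes "is_chain r R C"
  shows "Poly_Mapping.lookup (gen_minor r R C :: 'k::field mpoly) (perm_monom r R C id) = 1"
proof -
  have fin: "finite {\<sigma>. \<sigma> permutes {0..<r}}" by (simp add: finite_permutations)
  have "Poly_Mapping.lookup (gen_minor r R C :: 'k mpoly) (perm_monom r R C id)
      = (\<Sum>\<sigma> | \<sigma> permutes {0..<r}. if \<sigma> = id then 1 else 0)"
    unfolding gen_minor_expand lookup_sum
  proof (rule sum.cong)
    fix \<sigma> assume "\<sigma> \<in> {\<sigma>. \<sigma> permutes {0..<r}}"
    then have "perm_monom r R C \<sigma> \<noteq> perm_monom r R C id" if "\<sigma> \<noteq> id"
      using perm_monom_less[OF assms, of \<sigma>] that by auto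
    then show "Poly_Mapping.lookup (Poly_Mapping.single (perm_monom r R C \<sigma>) (of_int (sign \<sigma>)))
        (perm_monom r R C id) = (if \<sigma> = id then 1 else 0 :: 'k)"
      by (auto simp: lookup_single when_def)
  qed simp
  then show ?thesis using fin by simp
qed

lemma keys_gen_minor:
  "Poly_Mapping.keys (gen_minor r R C :: 'k::field mpoly) \<subseteq> perm_monom r R C ` {\<sigma>. \<sigma> permutes {0..<r}}"
  unfolding gen_minor_expand
  by (rule order.trans[OF keys_sum]) (auto split: if_splits)

section \<open>Matrices of rank less than \<open>r\<close>\<close>

text \<open>The inner index runs over only \<open>r - 1\<close> values. Padding with a zero column makes the two factors
  square, and the determinant of the first one vanishes.\<close>

lemma det_low_rank:
  fixes U W :: "nat \<Rightarrow> nat \<Rightarrow> 'a::comm_ring_1"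
  assumes "r \<ge> 1"
  shows "det (mat r r (\<lambda>(a, b). \<Sum>c\<in>{1..<r}. U a c * W c b)) = 0"
proof -
  let ?P = "mat r r (\<lambda>(a, c). if c = 0 then 0 else U a c)" and ?Q = "mat r r (\<lambda>(c, b). W c b)"
  have "mat r r (\<lambda>(a, b). \<Sum>c\<in>{1..<r}. U a c * W c b) = ?P * ?Q"
  proof (rule eq_matI)
    fix a b assume "a < dim_row (?P * ?Q)" "b < dim_col (?P * ?Q)"
    then have ab: "a < r" "b < r" by auto
    have "(?P * ?Q) $$ (a, b) = (\<Sum>c\<in>{0..<r}. (if c = 0 then 0 else U a c) * W c b)"
      using ab by (auto simp: scalar_prod_def intro!: sum.cong)
    also have "\<dots> = (\<Sum>c\<in>{1..<r}. U a c * W c b)"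
      by (rule sum.mono_neutral_cong_right) auto
    finally show "mat r r (\<lambda>(a, b). \<Sum>c\<in>{1..<r}. U a c * W c b) $$ (a, b) = (?P * ?Q) $$ (a, b)"
      using ab by simp
  qed auto
  moreover have "det ?P = 0"
  proof (subst det_col[of ?P r])
    show "(\<Sum>p | p permutes {0..<r}. of_int (sign p) * (\<Prod>j<r. ?P $$ (p j, j))) = 0"
    proof (intro sum.neutral ballI)
      fix p assume "p \<in> {p. p permutes {0..<r}}"
      then have "p 0 < r" using permutes_in_image[of p "{0..<r}" 0] assms by auto
      then have "(\<Prod>j<r. ?P $$ (p j, j)) = 0"
        using assms by (intro prod_zero) (auto intro!: bexI[of _ 0])
      then show "of_int (sign p) * (\<Prod>j<r. ?P $$ (p j, j)) = 0" by simp
    qed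
  qed simp
  moreover have "det (?P * ?Q) = det ?P * det ?Q" by (rule det_mult[of _ r]) auto
  ultimately show ?thesis by simp
qed

text \<open>The points \<open>A B\<close> with inner dimension \<open>r - 1\<close> parametrize the matrices of rank less than \<open>r\<close>.
  Vanishing on all of them stands in for membership in the ideal of generic \<open>r\<close>-minors.\<close>

definition low_rank_point ::
  "nat \<Rightarrow> (nat \<Rightarrow> nat \<Rightarrow> 'a) \<Rightarrow> (nat \<Rightarrow> nat \<Rightarrow> 'a) \<Rightarrow> nat \<times> nat \<Rightarrow> 'a::comm_ring_1" where
  "low_rank_point r A B = (\<lambda>(i, j). \<Sum>c\<in>{1..<r}. A i c * B c j)"

lemma gen_minor_vanishes:
  fixes h :: "'k::field \<Rightarrow> 'a::comm_ring_1"
  assumes "comm_ring_hom h" "r \<ge> 1"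
  shows "poly_at h (low_rank_point r A B) (gen_minor r R C) = 0"
proof -
  let ?p = "low_rank_point r A B"
  interpret ev: comm_ring_hom "poly_at h ?p" by (rule poly_at_hom) (rule assms)
  have "poly_at h ?p (gen_minor r R C)
      = det (map_mat (poly_at h ?p) (mat r r (\<lambda>(a, b). indet (R a, C b))))"
    unfolding gen_minor_def by (rule ev.hom_det[symmetric])
  also have "map_mat (poly_at h ?p) (mat r r (\<lambda>(a, b). indet (R a, C b)))
      = mat r r (\<lambda>(a, b). \<Sum>c\<in>{1..<r}. A (R a) c * B c (C b))"
    by (rule eq_matI) (auto simp: poly_at_indet[OF assms(1)] low_rank_point_def)
  also have "det \<dots> = 0" by (rule det_low_rank) (rule assms)
  finally show ?thesis .
qed

section \<open>Degeneration of points\<close>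

definition polyfun :: "('a::comm_ring_1 \<Rightarrow> 'a) \<Rightarrow> bool" where
  "polyfun g \<longleftrightarrow> (\<exists>q. \<forall>t. g t = poly q t)"

lemma polyfun_const [simp]: "polyfun (\<lambda>t. c)"
  unfolding polyfun_def by (rule exI[of _ "[:c:]"]) simp

lemma polyfun_ident [simp]: "polyfun (\<lambda>t. t)"
  unfolding polyfun_def by (rule exI[of _ "[:0, 1:]"]) simp

lemma polyfun_add: "polyfun f \<Longrightarrow> polyfun g \<Longrightarrow> polyfun (\<lambda>t. f t + g t)"
  unfolding polyfun_def by (metis poly_add)

lemma polyfun_mult: "polyfun f \<Longrightarrow> polyfun g \<Longrightarrow> polyfun (\<lambda>t. f t * g t)"
  unfolding polyfun_def by (metis poly_mult)

lemma polyfun_power: "polyfun f \<Longrightarrow> polyfun (\<lambda>t. f t ^ n)"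
  by (induction n) (simp_all add: polyfun_mult)

lemma polyfun_sum: "(\<And>i. i \<in> S \<Longrightarrow> polyfun (f i)) \<Longrightarrow> polyfun (\<lambda>t. \<Sum>i\<in>S. f i t)"
  by (induction S rule: infinite_finite_induct) (simp_all add: polyfun_add)

lemma polyfun_prod: "(\<And>i. i \<in> S \<Longrightarrow> polyfun (f i)) \<Longrightarrow> polyfun (\<lambda>t. \<Prod>i\<in>S. f i t)"
  by (induction S rule: infinite_finite_induct) (simp_all add: polyfun_mult)

lemma polyfun_if: "polyfun f \<Longrightarrow> polyfun g \<Longrightarrow> polyfun (\<lambda>t. if b then f t else g t)"
  by (cases b) simp_all

lemma polyfun_eq_zero:
  fixes g :: "'a::idom \<Rightarrow> 'a"
  assumes "polyfun g" "infinite (UNIV :: 'a set)" "finite S" "\<And>t. t \<notin> S \<Longrightarrow> g t = 0"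
  shows "g t = 0"
proof -
  obtain q where q: "\<And>t. g t = poly q t" using assms(1) by (auto simp: polyfun_def)
  have "infinite (- S)" using assms(2,3) by (metis Compl_eq_Diff_UNIV finite_Diff2)
  moreover have "- S \<subseteq> {t. poly q t = 0}" using assms(4) by (auto simp flip: q)
  ultimately have "q = 0" using poly_roots_finite[of q] finite_subset by blast
  then show ?thesis by (simp add: q)
qed

text \<open>Think of \<open>V\<close> as the set of all variables, of \<open>P\<close> as those already treated and of \<open>u\<close> as the leading
  monomial of \<open>f\<close>. The slice is the coefficient in \<open>f\<close> of the \<open>P\<close>-part of \<open>u\<close>, a polynomial in the
  variables \<open>V - P\<close>, evaluated at \<open>p\<close>. It is \<open>f\<close> itself for \<open>P = {}\<close> and the leading coefficient for
  \<open>P = V\<close>.\<close>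

definition slice_at ::
  "(nat \<times> nat) set \<Rightarrow> ('k::field \<Rightarrow> 'a::comm_ring_1) \<Rightarrow> 'k mpoly \<Rightarrow> monomial \<Rightarrow> (nat \<times> nat) set \<Rightarrow>
    (nat \<times> nat \<Rightarrow> 'a) \<Rightarrow> 'a" where
  "slice_at V h f u P p =
     (\<Sum>w | w \<in> Poly_Mapping.keys f \<and> (\<forall>x\<in>P. Poly_Mapping.lookup w x = Poly_Mapping.lookup u x).
        h (Poly_Mapping.lookup f w) * (\<Prod>x\<in>V - P. p x ^ Poly_Mapping.lookup w x))"

lemma slice_at_cong:
  assumes "\<And>x. x \<in> V - P \<Longrightarrow> p x = q x"
  shows "slice_at V h f u P p = slice_at V h f u P q"
  unfolding slice_at_def using assms by (intro sum.cong refl arg_cong2[of _ _ _ _ "(*)"] prod.cong) auto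

lemma polyfun_slice_at:
  assumes "\<And>x. x \<in> V \<Longrightarrow> polyfun (\<lambda>t. q t x)"
  shows "polyfun (\<lambda>t. slice_at V h f u P (q t))"
  unfolding slice_at_def
  using assms by (intro polyfun_sum polyfun_mult polyfun_prod polyfun_power polyfun_const) auto

text \<open>Along a curve \<open>q t\<close> on which the slice vanishes, let the coordinate \<open>v\<close> have a simple pole at
  \<open>t = 0\<close> while the remaining coordinates stay finite. The term of top degree in \<open>v\<close>, which by
  assumption is the degree of \<open>u\<close>, dominates as \<open>t\<close> tends to 0, so its coefficient vanishes at the limit
  point. The passage to the limit is algebraic: multiplied by \<open>t\<close> to that degree, the slice is a
  polynomial function of \<open>t\<close> that is zero for all \<open>t \<noteq> 0\<close>, hence also at 0.\<close>

lemma slice_at_degenerate: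
  fixes h :: "'k::field \<Rightarrow> 'a::idom"
  assumes inf: "infinite (UNIV :: 'a set)" and V: "finite V" and v: "v \<in> V - P"
    and top: "\<And>w. w \<in> Poly_Mapping.keys f \<Longrightarrow>
      (\<And>x. x \<in> P \<Longrightarrow> Poly_Mapping.lookup w x = Poly_Mapping.lookup u x) \<Longrightarrow>
      Poly_Mapping.lookup w v \<le> Poly_Mapping.lookup u v"
    and zero: "\<And>t. t \<noteq> 0 \<Longrightarrow> slice_at V h f u P (q t) = 0"
    and g: "polyfun g" "\<And>t. t \<noteq> 0 \<Longrightarrow> t * q t v = g t" "g 0 \<noteq> 0"
    and Q: "\<And>x. polyfun (Q x)" "\<And>x t. x \<in> V - insert v P \<Longrightarrow> t \<noteq> 0 \<Longrightarrow> q t x = Q x t"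
  shows "slice_at V h f u (insert v P) (\<lambda>x. Q x 0) = 0"
proof -
  define D where "D = Poly_Mapping.lookup u v"
  define W where "W = {w \<in> Poly_Mapping.keys f. \<forall>x\<in>P. Poly_Mapping.lookup w x = Poly_Mapping.lookup u x}"
  define M where "M w t = (\<Prod>x\<in>V - insert v P. Q x t ^ Poly_Mapping.lookup w x)" for w t
  define G where "G t = (\<Sum>w\<in>W. h (Poly_Mapping.lookup f w) *
      (g t ^ Poly_Mapping.lookup w v * t ^ (D - Poly_Mapping.lookup w v) * M w t))" for t
  have le: "Poly_Mapping.lookup w v \<le> D" if "w \<in> W" for w
    using top[of w] that by (auto simp: W_def D_def)
  have finW: "finite W" by (simp add: W_def)
  have split: "V - P = insert v (V - insert v P)" using v by auto
  have G0: "G t = 0" if t: "t \<noteq> 0" for t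
  proof -
    have "G t = (\<Sum>w\<in>W. t ^ D * (h (Poly_Mapping.lookup f w) * (\<Prod>x\<in>V - P. q t x ^ Poly_Mapping.lookup w x)))"
      unfolding G_def
    proof (rule sum.cong)
      fix w assume w: "w \<in> W"
      have "(\<Prod>x\<in>V - insert v P. q t x ^ Poly_Mapping.lookup w x) = M w t"
        unfolding M_def using Q(2) t by (intro prod.cong) auto
      then have p: "(\<Prod>x\<in>V - P. q t x ^ Poly_Mapping.lookup w x) = q t v ^ Poly_Mapping.lookup w v * M w t"
        unfolding split using V by (subst prod.insert) auto
      have "t ^ D = t ^ Poly_Mapping.lookup w v * t ^ (D - Poly_Mapping.lookup w v)"
        using le[OF w] by (simp flip: power_add)
      then show "h (Poly_Mapping.lookup f w) * (g t ^ Poly_Mapping.lookup w v * t ^ (D - Poly_Mapping.lookup w v) * M w t)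
        = t ^ D * (h (Poly_Mapping.lookup f w) * (\<Prod>x\<in>V - P. q t x ^ Poly_Mapping.lookup w x))"
        unfolding p g(2)[OF t, symmetric] by (simp add: power_mult_distrib mult_ac)
    qed simp
    also have "\<dots> = t ^ D * slice_at V h f u P (q t)"
      by (simp add: slice_at_def W_def sum_distrib_left)
    finally show ?thesis using zero[OF t] by simp
  qed
  have "polyfun G" unfolding G_def M_def
    by (intro polyfun_sum polyfun_mult polyfun_prod polyfun_power polyfun_const polyfun_ident g Q)
  then have "G 0 = 0" by (rule polyfun_eq_zero[OF _ inf, of _ "{0}"]) (simp_all add: G0)
  moreover have "G 0 = g 0 ^ D * slice_at V h f u (insert v P) (\<lambda>x. Q x 0)"
  proof -
    have "G 0 = (\<Sum>w | w \<in> W \<and> Poly_Mapping.lookup w v = D. h (Poly_Mapping.lookup f w) * (g 0 ^ D * M w 0))"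
      unfolding G_def
      by (rule sum.mono_neutral_cong_right) (use finW le in \<open>auto simp: power_0_left\<close>, fastforce dest: le)
    also have "{w. w \<in> W \<and> Poly_Mapping.lookup w v = D} = {w \<in> Poly_Mapping.keys f.
        \<forall>x\<in>insert v P. Poly_Mapping.lookup w x = Poly_Mapping.lookup u x}"
      by (auto simp: W_def D_def)
    finally show ?thesis by (simp add: slice_at_def M_def sum_distrib_left mult_ac)
  qed
  ultimately show ?thesis using g(3) by simp
qed

lemma slice_at_skip:
  assumes V: "finite V" and v: "v \<in> V - P" and u: "Poly_Mapping.lookup u v = 0"
    and top: "\<And>w. w \<in> Poly_Mapping.keys f \<Longrightarrow>
      (\<And>x. x \<in> P \<Longrightarrow> Poly_Mapping.lookup w x = Poly_Mapping.lookup u x) \<Longrightarrow>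
      Poly_Mapping.lookup w v \<le> Poly_Mapping.lookup u v"
  shows "slice_at V h f u (insert v P) p = slice_at V h f u P p"
proof -
  have split: "V - P = insert v (V - insert v P)" using v by auto
  have eq: "{w \<in> Poly_Mapping.keys f. \<forall>x\<in>insert v P. Poly_Mapping.lookup w x = Poly_Mapping.lookup u x}
      = {w \<in> Poly_Mapping.keys f. \<forall>x\<in>P. Poly_Mapping.lookup w x = Poly_Mapping.lookup u x}"
    using top u by fastforce
  show ?thesis
    unfolding slice_at_def eq
  proof (rule sum.cong)
    fix w assume "w \<in> {w \<in> Poly_Mapping.keys f. \<forall>x\<in>P. Poly_Mapping.lookup w x = Poly_Mapping.lookup u x}"
    then have "Poly_Mapping.lookup w v = 0" using top[of w] u by auto
    then have "(\<Prod>x\<in>V - P. p x ^ Poly_Mapping.lookup w x) = (\<Prod>x\<in>V - insert v P. p x ^ Poly_Mapping.lookup w x)"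
      unfolding split using V by (subst prod.insert) auto
    then show "h (Poly_Mapping.lookup f w) * (\<Prod>x\<in>V - insert v P. p x ^ Poly_Mapping.lookup w x)
      = h (Poly_Mapping.lookup f w) * (\<Prod>x\<in>V - P. p x ^ Poly_Mapping.lookup w x)" by simp
  qed simp
qed

section \<open>Chains in the support of a monomial\<close>

text \<open>Patience sorting. For \<open>c > 0\<close>, \<open>chain_end u m i c\<close> is the least column in which a strictly
  increasing chain of \<open>c\<close> positions of the support of \<open>u\<close>, with rows from 1 to \<open>i\<close> and columns from 1
  to \<open>m\<close>, can end, and \<open>m + 1\<close> if there is no such chain. A position \<open>(i, k)\<close> extends a chain of length
  \<open>c - 1\<close> in the rows above exactly when \<open>th (c - 1) < k\<close>. Within a row the comparison is made with
  the thresholds \<open>th\<close> of the rows above, since a chain uses a row at most once.\<close>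

primrec row_scan :: "monomial \<Rightarrow> nat \<Rightarrow> (nat \<Rightarrow> nat) \<Rightarrow> nat \<Rightarrow> nat \<Rightarrow> nat" where
  "row_scan u i th 0 = th"
| "row_scan u i th (Suc l) = (\<lambda>c.
     if 0 < Poly_Mapping.lookup u (i, Suc l) \<and> th (c - 1) < Suc l \<and> Suc l \<le> th c
     then min (Suc l) (row_scan u i th l c) else row_scan u i th l c)"

primrec chain_end :: "monomial \<Rightarrow> nat \<Rightarrow> nat \<Rightarrow> nat \<Rightarrow> nat" where
  "chain_end u m 0 = (\<lambda>c. if c = 0 then 0 else Suc m)"
| "chain_end u m (Suc i) = row_scan u (Suc i) (chain_end u m i) m"

lemma row_scan_cases:
  "row_scan u i th l c = th c \<or>
   (i, row_scan u i th l c) \<in> Poly_Mapping.keys u \<and> th (c - 1) < row_scan u i th l c \<and> row_scan u i th l c \<le> th c"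
  by (induction l) (auto simp: in_keys_iff min_def)

lemma chain_end_zero: "chain_end u m i 0 = 0"
proof (induction i)
  case (Suc i)
  then show ?case using row_scan_cases[of u "Suc i" "chain_end u m i" m 0] by auto
qed simp

lemma mono_chain_end: "mono (chain_end u m i)"
proof (induction i)
  case 0
  show ?case by (auto simp: mono_def)
next
  case (Suc i)
  have "chain_end u m (Suc i) c \<le> chain_end u m (Suc i) (Suc c)" for c
    using row_scan_cases[of u "Suc i" "chain_end u m i" m c]
      row_scan_cases[of u "Suc i" "chain_end u m i" m "Suc c"] monoD[OF Suc, of c "Suc c"]
    by auto
  then show ?case by (simp add: mono_iff_le_Suc)
qed

definition chain_in :: "nat \<Rightarrow> (nat \<times> nat) set \<Rightarrow> bool" where
  "chain_in r S \<longleftrightarrow> (\<exists>R C. is_chain r R C \<and> (\<lambda>a. (R a, C a)) ` {0..<r} \<subseteq> S)"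

lemma chain_in_extend:
  assumes "chain_in c {x \<in> S. fst x < i \<and> snd x < k}" "(i, k) \<in> S"
  shows "chain_in (Suc c) {x \<in> S. fst x \<le> i \<and> snd x \<le> k}"
proof -
  obtain R C where ch: "is_chain c R C"
    and sub: "\<And>a. a < c \<Longrightarrow> (R a, C a) \<in> S \<and> R a < i \<and> C a < k"
    using assms(1) by (fastforce simp: chain_in_def)
  have "is_chain (Suc c) (R(c := i)) (C(c := k))"
    using ch sub by (auto simp: is_chain_def strict_mono_on_def less_Suc_eq)
  moreover have "(\<lambda>a. ((R(c := i)) a, (C(c := k)) a)) ` {0..<Suc c} \<subseteq> {x \<in> S. fst x \<le> i \<and> snd x \<le> k}"
    using sub assms(2) by (auto simp: less_Suc_eq less_imp_le)
  ultimately show ?thesis unfolding chain_in_def by blast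
qed

lemma chain_in_mono: "chain_in r S \<Longrightarrow> S \<subseteq> T \<Longrightarrow> chain_in r T"
  unfolding chain_in_def by blast

lemma chain_in_zero: "chain_in 0 S"
  by (auto simp: chain_in_def is_chain_def)

lemma chain_end_chain:
  assumes "chain_end u m i c \<le> m"
  shows "chain_in c {x \<in> Poly_Mapping.keys u. fst x \<le> i \<and> snd x \<le> chain_end u m i c}"
  using assms
proof (induction i arbitrary: c)
  case 0
  then show ?case by (auto split: if_splits intro: chain_in_zero)
next
  case (Suc i)
  let ?e = "chain_end u m i" and ?k = "chain_end u m (Suc i) c"
  show ?case
  proof (cases "?k = ?e c")
    case True
    then have "chain_in c {x \<in> Poly_Mapping.keys u. fst x \<le> i \<and> snd x \<le> ?e c}"
      using Suc by simp
    then show ?thesis by (rule chain_in_mono) (use True in auto)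
  next
    case False
    then have k: "(Suc i, ?k) \<in> Poly_Mapping.keys u" "?e (c - 1) < ?k" "?k \<le> ?e c"
      using row_scan_cases[of u "Suc i" ?e m c] by auto
    then obtain c' where c: "c = Suc c'" using chain_end_zero[of u m i] by (cases c) auto
    have "chain_in c' {x \<in> Poly_Mapping.keys u. fst x \<le> i \<and> snd x \<le> ?e c'}"
      using Suc.IH[of c'] Suc.prems k(2) c by simp
    then have "chain_in c' {x \<in> Poly_Mapping.keys u. fst x < Suc i \<and> snd x < ?k}"
      by (rule chain_in_mono) (use k(2) c in auto)
    from chain_in_extend[OF this k(1)] show ?thesis unfolding c .
  qed
qed

text \<open>Otherwise this position would extend a chain of length \<open>r - 1\<close> that ends strictly to the left of it
  in the rows above.\<close>

lemma support_below_chain_end: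
  assumes "\<not> chain_in r (Poly_Mapping.keys u)" "(Suc i, k) \<in> Poly_Mapping.keys u" "k \<le> m" "r \<ge> 1"
  shows "k \<le> chain_end u m i (r - 1)"
proof (rule ccontr)
  assume "\<not> k \<le> chain_end u m i (r - 1)"
  then have lt: "chain_end u m i (r - 1) < k" by simp
  then have "chain_in (r - 1) {x \<in> Poly_Mapping.keys u. fst x \<le> i \<and> snd x \<le> chain_end u m i (r - 1)}"
    using assms(3) by (intro chain_end_chain) simp
  then have "chain_in (r - 1) {x \<in> Poly_Mapping.keys u. fst x < Suc i \<and> snd x < k}"
    by (rule chain_in_mono) (use lt in auto)
  from chain_in_extend[OF this assms(2)] have "chain_in r (Poly_Mapping.keys u)"
    using assms(4) by (auto elim: chain_in_mono)
  then show False using assms(1) by simp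
qed

section \<open>The leading monomial of a polynomial vanishing at low rank\<close>

text \<open>The product \<open>A B\<close> in which row \<open>c\<close> of \<open>B\<close> is cut off after a threshold column; row \<open>i\<close> of the product still
  uses the threshold \<open>old c\<close> while all the other rows use \<open>new c\<close>.
  For increasing thresholds, the columns beyond the threshold of \<open>c\<close> only involve the \<open>r - 1 - c\<close> rows of
  \<open>B\<close> below row \<open>c\<close>, so they have rank at most \<open>r - 1 - c\<close>.\<close>

definition staircase_point ::
  "nat \<Rightarrow> (nat \<Rightarrow> nat) \<Rightarrow> (nat \<Rightarrow> nat) \<Rightarrow> nat \<Rightarrow> (nat \<Rightarrow> nat \<Rightarrow> 'a) \<Rightarrow> (nat \<Rightarrow> nat \<Rightarrow> 'a) \<Rightarrow>
     nat \<times> nat \<Rightarrow> 'a::comm_ring_1" where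
  "staircase_point r old new i A B = (\<lambda>(p, k). \<Sum>c\<in>{1..<r}.
     if k \<le> (if p = i then old c else new c) then A p c * B c k else 0)"

definition scanned :: "nat \<Rightarrow> nat \<Rightarrow> (nat \<times> nat) set \<Rightarrow> (nat \<times> nat) set" where
  "scanned i l V = {x \<in> V. fst x < i \<or> fst x = i \<and> snd x \<le> l}"

lemma block_exists:
  fixes th :: "nat \<Rightarrow> nat"
  assumes "th 0 = 0" "0 < k" "k \<le> th N"
  obtains a where "1 \<le> a" "a \<le> N" "th (a - 1) < k" "k \<le> th a"
proof -
  define a where "a = (LEAST a. k \<le> th a)"
  have "k \<le> th a" unfolding a_def by (rule LeastI, rule assms(3))
  moreover have "a \<le> N" unfolding a_def by (rule Least_le, rule assms(3))
  moreover have "1 \<le> a" using \<open>k \<le> th a\<close> assms(1,2) by (cases a) auto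
  moreover have "th (a - 1) < k"
    using not_less_Least[of "a - 1" "\<lambda>a. k \<le> th a"] \<open>1 \<le> a\<close> unfolding a_def by simp
  ultimately show ?thesis using that by blast
qed

text \<open>The heart of the proof. If \<open>u\<close> contains the variable \<open>(i, Suc l)\<close>, passing it brings the new threshold of
  the \<open>a\<close> whose block \<open>old (a - 1) < Suc l \<le> old a\<close> contains the column \<open>Suc l\<close> down to at most \<open>Suc l\<close>.
  To reach the points for the new thresholds as limits, divide the entry \<open>A i a\<close> by \<open>t\<close> and multiply the
  entries of row \<open>a\<close> of \<open>B\<close> to the right of column \<open>Suc l\<close> by \<open>t\<close>. In row \<open>i\<close> the two effects cancel to the
  right of that column, and the entry at \<open>(i, Suc l)\<close> gets a simple pole with residue
  \<open>A i a * B a (Suc l)\<close>. In the rows still to come the contribution of \<open>a\<close> beyond column \<open>Suc l\<close> tends to 0, and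
  this is the effect of the new threshold. The residue has to be nonzero, but
  this restriction on \<open>A\<close> and \<open>B\<close> is removed afterwards, because a polynomial function on an infinite
  field that vanishes outside a finite set is zero.\<close>

lemma slice_at_step:
  fixes h :: "'k::field \<Rightarrow> 'a::field"
  assumes inf: "infinite (UNIV :: 'a set)" and V: "finite V" and v: "(i, Suc l) \<in> V"
    and top: "\<And>w. w \<in> Poly_Mapping.keys f \<Longrightarrow>
      (\<And>x. x \<in> scanned i l V \<Longrightarrow> Poly_Mapping.lookup w x = Poly_Mapping.lookup u x) \<Longrightarrow>
      Poly_Mapping.lookup w (i, Suc l) \<le> Poly_Mapping.lookup u (i, Suc l)"
    and old: "mono old" "old 0 = 0" "(i, Suc l) \<in> Poly_Mapping.keys u \<Longrightarrow> Suc l \<le> old (r - 1)"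
    and van: "\<And>A B. slice_at V h f u (scanned i l V) (staircase_point r old (row_scan u i old l) i A B) = 0"
  shows "slice_at V h f u (scanned i (Suc l) V) (staircase_point r old (row_scan u i old (Suc l)) i A B) = 0"
proof -
  let ?v = "(i, Suc l)" and ?P = "scanned i l V" and ?P' = "scanned i (Suc l) V"
  let ?new = "row_scan u i old l" and ?new' = "row_scan u i old (Suc l)"
  have P': "?P' = insert ?v ?P" and vP: "?v \<in> V - ?P" using v by (auto simp: scanned_def)
  show ?thesis
  proof (cases "Poly_Mapping.lookup u ?v = 0")
    case True
    then have "?new' = ?new" by auto
    then show ?thesis
      unfolding P' using slice_at_skip[OF V vP True top] van by metis
  next
    case False
    then have "Suc l \<le> old (r - 1)" using old(3) by (simp add: in_keys_iff)
    then obtain a where "1 \<le> a" "a \<le> r - 1" and a: "old (a - 1) < Suc l" "Suc l \<le> old a"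
      using block_exists[of old "Suc l" "r - 1"] old(2) by auto
    then have ar: "a \<in> {1..<r}" by auto
    \<comment> \<open>By monotonicity only one block contains the column.\<close>
    have new': "?new' c = (if c = a then min (Suc l) (?new c) else ?new c)" for c
    proof -
      have other: "\<not> (old (c - 1) < Suc l \<and> Suc l \<le> old c)" if "c \<noteq> a"
      proof (cases "c < a")
        case True
        then have "old c \<le> old (a - 1)" using monoD[OF old(1), of c "a - 1"] by simp
        then show ?thesis using a by simp
      next
        case False
        then have "old a \<le> old (c - 1)" using monoD[OF old(1), of a "c - 1"] that by simp
        then show ?thesis using a by simp
      qed
      show ?thesis
      proof (cases "c = a")
        case True
        then show ?thesis using a \<open>Poly_Mapping.lookup u ?v \<noteq> 0\<close> by simp
      next
        case False
        then show ?thesis using other by (simp only: row_scan.simps if_False simp_thms)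
      qed
    qed
    have generic: "slice_at V h f u ?P' (staircase_point r old ?new' i A B) = 0"
      if nz: "A i a \<noteq> 0" "B a (Suc l) \<noteq> 0" for A B
    proof -
      define At where "At t = A(i := (A i)(a := A i a / t))" for t
      define Bt where "Bt t = B(a := (\<lambda>k. if Suc l < k then t * B a k else B a k))" for t
      define q where "q t = staircase_point r old ?new i (At t) (Bt t)" for t
      define Q where "Q = (\<lambda>(p, k) t. \<Sum>c\<in>{1..<r}. if k \<le> (if p = i then old c else ?new c)
          then (if p \<noteq> i \<and> c = a \<and> Suc l < k then t * (A p c * B c k) else A p c * B c k) else 0)"
      define g where "g t = A i a * B a (Suc l) +
          t * (\<Sum>c\<in>{1..<r} - {a}. if Suc l \<le> old c then A i c * B c (Suc l) else 0)" for t
      have "slice_at V h f u (insert ?v ?P) (\<lambda>x. Q x 0) = 0"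
      proof (rule slice_at_degenerate[OF inf V vP top, where q = q and g = g])
        show "slice_at V h f u ?P (q t) = 0" for t unfolding q_def by (rule van)
        show "polyfun g" unfolding g_def
          by (intro polyfun_add polyfun_mult polyfun_const polyfun_ident)
        show "g 0 \<noteq> 0" using nz by (simp add: g_def)
        show "polyfun (Q x)" for x
          unfolding Q_def split_beta
          by (intro polyfun_sum polyfun_if polyfun_mult polyfun_const polyfun_ident)
        show "t * q t ?v = g t" if t: "t \<noteq> 0" for t
        proof -
          have "q t ?v = (\<Sum>c\<in>{1..<r}. if Suc l \<le> old c then At t i c * Bt t c (Suc l) else 0)"
            by (simp add: q_def staircase_point_def)
          also have "\<dots> = At t i a * Bt t a (Suc l) +
              (\<Sum>c\<in>{1..<r} - {a}. if Suc l \<le> old c then At t i c * Bt t c (Suc l) else 0)"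
            using a ar by (subst sum.remove[of _ a]) auto
          also have "(\<Sum>c\<in>{1..<r} - {a}. if Suc l \<le> old c then At t i c * Bt t c (Suc l) else 0)
              = (\<Sum>c\<in>{1..<r} - {a}. if Suc l \<le> old c then A i c * B c (Suc l) else 0)"
            by (rule sum.cong) (auto simp: At_def Bt_def)
          finally show ?thesis using t by (simp add: g_def At_def Bt_def field_simps)
        qed
        show "q t x = Q x t" if x: "x \<in> V - insert ?v ?P" and t: "t \<noteq> 0" for x t
        proof -
          obtain p k where pk: "x = (p, k)" by force
          then have "p > i \<or> p = i \<and> Suc l < k" using x by (auto simp: scanned_def)
          then show ?thesis
            unfolding pk q_def Q_def staircase_point_def prod.case
            using t by (intro sum.cong) (auto simp: At_def Bt_def)
        qed
      qed
      moreover have "Q x 0 = staircase_point r old ?new' i A B x" if "x \<in> V - insert ?v ?P" for x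
      proof -
        obtain p k where pk: "x = (p, k)" by force
        show ?thesis
          unfolding pk Q_def staircase_point_def prod.case new'
          by (intro sum.cong) auto
      qed
      ultimately show ?thesis unfolding P' using slice_at_cong by (metis (no_types, lifting))
    qed
    \<comment> \<open>Moving the two critical entries by \<open>s\<close> makes both nonzero for all but two values of \<open>s\<close>.\<close>
    define As where "As s = A(i := (A i)(a := A i a + s))" for s
    define Bs where "Bs s = B(a := (B a)(Suc l := B a (Suc l) + s))" for s
    have "slice_at V h f u ?P' (staircase_point r old ?new' i (As 0) (Bs 0)) = 0"
    proof (rule polyfun_eq_zero[OF _ inf, where S = "{- A i a, - B a (Suc l)}" and
          g = "\<lambda>s. slice_at V h f u ?P' (staircase_point r old ?new' i (As s) (Bs s))"])
      have "polyfun (\<lambda>s. As s p c)" "polyfun (\<lambda>s. Bs s c k)" for p c k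
        by (cases "p = i"; cases "c = a"; cases "k = Suc l"; simp add: As_def Bs_def polyfun_add)+
      then have "polyfun (\<lambda>s. staircase_point r old ?new' i (As s) (Bs s) x)" for x
        unfolding staircase_point_def split_beta
        by (intro polyfun_sum polyfun_if polyfun_mult polyfun_const)
      then show "polyfun (\<lambda>s. slice_at V h f u ?P' (staircase_point r old ?new' i (As s) (Bs s)))"
        by (rule polyfun_slice_at)
      show "slice_at V h f u ?P' (staircase_point r old ?new' i (As s) (Bs s)) = 0"
        if "s \<notin> {- A i a, - B a (Suc l)}" for s
        using that by (intro generic) (auto simp: As_def Bs_def add_eq_0_iff)
    qed simp
    then show ?thesis by (simp add: As_def Bs_def)
  qed
qed

lemma lead_monom_top:
  fixes f :: "'k::field mpoly"
  assumes w: "w \<in> Poly_Mapping.keys f"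
    and eq: "\<And>x. x < v \<Longrightarrow> Poly_Mapping.lookup w x = Poly_Mapping.lookup (lead_monom f) x"
  shows "Poly_Mapping.lookup w v \<le> Poly_Mapping.lookup (lead_monom f) v"
proof (rule ccontr)
  assume "\<not> ?thesis"
  then have "lead_monom f < w"
    unfolding less_poly_mapping.rep_eq less_fun_def using eq by (intro exI[of _ v]) auto
  moreover have "w \<le> lead_monom f" using w by (simp add: lead_monom_def)
  ultimately show False by simp
qed

text \<open>Suppose the leading monomial \<open>u\<close> has no \<open>r\<close>-chain. Then its support never leaves the first \<open>r - 1\<close>
  thresholds, so the degeneration step applies to every variable in turn, in decreasing order. The
  slices vanish at all the staircase points met on the way, starting from the vanishing of \<open>f\<close> at low rank. After
  the last variable the slice is the leading coefficient, which is not zero.\<close>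

lemma lead_monom_has_chain:
  fixes f :: "'k::field mpoly" and h :: "'k \<Rightarrow> 'a::field"
  assumes h: "comm_ring_hom h" and inf: "infinite (UNIV :: 'a set)" and r: "r \<ge> 1"
    and V: "V = {1..n} \<times> {1..m}" and f: "f \<in> carrier (poly_ring V)" "f \<noteq> 0"
    and van: "\<And>A B. poly_at h (low_rank_point r A B) f = 0"
  shows "chain_in r (Poly_Mapping.keys (lead_monom f))"
proof (rule ccontr)
  define u where "u = lead_monom f"
  assume "\<not> ?thesis"
  then have nch: "\<not> chain_in r (Poly_Mapping.keys u)" by (simp add: u_def)
  have finV: "finite V" by (simp add: V)
  have keysV: "Poly_Mapping.keys w \<subseteq> V" if "w \<in> Poly_Mapping.keys f" for w
    using f(1) that by (auto simp: poly_ring_def)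
  have uf: "u \<in> Poly_Mapping.keys f" unfolding u_def lead_monom_def using f(2) by (intro Max_in) auto
  let ?e = "chain_end u m"
  \<comment> \<open>Lexicographic maximality of \<open>u\<close>, once the earlier exponents agree.\<close>
  have top: "Poly_Mapping.lookup w (i, Suc l) \<le> Poly_Mapping.lookup u (i, Suc l)"
    if w: "w \<in> Poly_Mapping.keys f"
      and eq: "\<And>x. x \<in> scanned i l V \<Longrightarrow> Poly_Mapping.lookup w x = Poly_Mapping.lookup u x" for w i l
    unfolding u_def
  proof (rule lead_monom_top[OF w])
    fix x :: "nat \<times> nat" assume x: "x < (i, Suc l)"
    show "Poly_Mapping.lookup w x = Poly_Mapping.lookup (lead_monom f) x"
    proof (cases "x \<in> V")
      case True
      then have "x \<in> scanned i l V" using x by (cases x) (auto simp: scanned_def)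
      then show ?thesis using eq by (simp add: u_def)
    next
      case False
      then have "x \<notin> Poly_Mapping.keys w" "x \<notin> Poly_Mapping.keys u"
        using keysV[OF w] keysV[OF uf] by auto
      then show ?thesis by (simp add: u_def in_keys_iff)
    qed
  qed
  have rows: "slice_at V h f u (scanned i m V) (staircase_point r (?e i) (?e i) i A B) = 0"
    if "i \<le> n" for i A B
    using that
  proof (induction i arbitrary: A B)
    case 0
    have e: "scanned 0 m V = {}" by (auto simp: scanned_def V)
    have "slice_at V h f u {} (staircase_point r (?e 0) (?e 0) 0 A B)
        = slice_at V h f u {} (low_rank_point r A B)"
      by (rule slice_at_cong) (auto simp: staircase_point_def low_rank_point_def V intro!: sum.cong)
    also have "\<dots> = poly_at h (low_rank_point r A B) f"
      unfolding slice_at_def poly_at_def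
      by (rule sum.cong) (simp_all only: monom_at_superset[OF finV keysV] Diff_empty ball_simps simp_thms Collect_mem_eq)
    finally show ?case unfolding e using van by simp
  next
    case (Suc i)
    have cols: "slice_at V h f u (scanned (Suc i) l V)
        (staircase_point r (?e i) (row_scan u (Suc i) (?e i) l) (Suc i) A B) = 0"
      if "l \<le> m" for l A B
      using that
    proof (induction l arbitrary: A B)
      case 0
      have "scanned (Suc i) 0 V = scanned i m V" by (auto simp: scanned_def V)
      moreover have "staircase_point r (?e i) (row_scan u (Suc i) (?e i) 0) (Suc i) A B
          = staircase_point r (?e i) (?e i) i A B"
        by (auto simp: staircase_point_def fun_eq_iff)
      ultimately show ?case using Suc by simp
    next
      case (Suc l)
      show ?case
      proof (rule slice_at_step[OF inf finV _ top mono_chain_end chain_end_zero])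
        show "(Suc i, Suc l) \<in> V" using Suc.prems \<open>Suc i \<le> n\<close> by (auto simp: V)
        show "Suc l \<le> ?e i (r - 1)" if "(Suc i, Suc l) \<in> Poly_Mapping.keys u"
          using support_below_chain_end[OF nch that] Suc.prems r by simp
        show "slice_at V h f u (scanned (Suc i) l V)
            (staircase_point r (?e i) (row_scan u (Suc i) (?e i) l) (Suc i) A B) = 0" for A B
          using Suc by simp
      qed
    qed
    have "slice_at V h f u (scanned (Suc i) m V) (staircase_point r (?e (Suc i)) (?e (Suc i)) (Suc i) A B)
      = slice_at V h f u (scanned (Suc i) m V)
        (staircase_point r (?e i) (row_scan u (Suc i) (?e i) m) (Suc i) A B)"
      by (rule slice_at_cong) (auto simp: staircase_point_def scanned_def V intro!: sum.cong)
    then show ?case using cols by simp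
  qed
  have "scanned n m V = V" by (auto simp: scanned_def V)
  moreover have "{w \<in> Poly_Mapping.keys f. \<forall>x\<in>V. Poly_Mapping.lookup w x = Poly_Mapping.lookup u x} = {u}"
  proof -
    have "w = u" if "w \<in> Poly_Mapping.keys f" "\<forall>x\<in>V. Poly_Mapping.lookup w x = Poly_Mapping.lookup u x" for w
    proof (rule poly_mapping_eqI)
      fix x show "Poly_Mapping.lookup w x = Poly_Mapping.lookup u x"
        using that keysV[OF uf] keysV[OF that(1)] by (metis in_keys_iff subsetD)
    qed
    then show ?thesis using uf by auto
  qed
  ultimately have "h (Poly_Mapping.lookup f u) = 0"
    using rows[of n] by (simp add: slice_at_def)
  moreover have "h (Poly_Mapping.lookup f u) * h (inverse (Poly_Mapping.lookup f u)) = 1"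
  proof -
    interpret comm_ring_hom h by (rule h)
    show ?thesis using uf by (simp add: in_keys_iff flip: hom_mult)
  qed
  ultimately show False by simp
qed

section \<open>Setting variables to zero\<close>

lemma carrier_poly_ring_iff:
  "f \<in> carrier (poly_ring V) \<longleftrightarrow> (\<forall>w\<in>Poly_Mapping.keys f. Poly_Mapping.keys w \<subseteq> V)"
  by (simp add: poly_ring_def)

lemma poly_ring_ops [simp]:
  "x \<otimes>\<^bsub>poly_ring V\<^esub> y = x * y" "\<one>\<^bsub>poly_ring V\<^esub> = 1"
  "x \<oplus>\<^bsub>poly_ring V\<^esub> y = x + y" "\<zero>\<^bsub>poly_ring V\<^esub> = 0"
  by (simp_all add: poly_ring_def)

lemma a_inv_poly_ring:
  assumes "f \<in> carrier (poly_ring V)"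
  shows "\<ominus>\<^bsub>poly_ring V\<^esub> f = - f"
proof -
  interpret cring "poly_ring V" by (rule cring_poly_ring)
  have "- f \<in> carrier (poly_ring V)" using assms by (simp add: carrier_poly_ring_iff)
  then show ?thesis using assms by (intro minus_equality) simp_all
qed

text \<open>Written as an evaluation, so that it is a ring homomorphism by the general fact.\<close>

definition kill_vars :: "(nat \<times> nat) set \<Rightarrow> 'k::field mpoly \<Rightarrow> 'k mpoly" where
  "kill_vars V f = poly_at (Poly_Mapping.single 0) (\<lambda>x. if x \<in> V then indet x else 0) f"

lemma single_zero_hom: "comm_ring_hom (Poly_Mapping.single 0 :: 'k::field \<Rightarrow> 'k mpoly)"
  by unfold_locales (simp_all add: single_add mult_single)

lemma kill_vars_hom: "comm_ring_hom (kill_vars V)"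
  unfolding kill_vars_def by (rule poly_at_hom[OF single_zero_hom])

lemma indet_power: "indet x ^ e = mono_poly (Poly_Mapping.single x e)"
  by (induction e) (simp_all add: indet_def mono_poly_zero flip: mono_poly_add single_add)

lemma lookup_kill_vars:
  "Poly_Mapping.lookup (kill_vars V f) w = (if Poly_Mapping.keys w \<subseteq> V then Poly_Mapping.lookup f w else 0)"
proof -
  let ?p = "\<lambda>x. if x \<in> V then indet x else 0 :: 'a mpoly"
  have mon: "monom_at ?p u = (if Poly_Mapping.keys u \<subseteq> V then mono_poly u else 0)" for u
  proof (cases "Poly_Mapping.keys u \<subseteq> V")
    case True
    have "monom_at ?p u = (\<Prod>x\<in>Poly_Mapping.keys u. mono_poly (Poly_Mapping.single x (Poly_Mapping.lookup u x)))"
      unfolding monom_at_def by (rule prod.cong) (use True in \<open>auto simp: indet_power\<close>)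
    also have "\<dots> = mono_poly u"
      by (subst (3) poly_mapping_eq_sum_single[of u]) (simp add: mono_poly_sum)
    finally show ?thesis using True by simp
  next
    case False
    then obtain x where "x \<in> Poly_Mapping.keys u" "x \<notin> V" by auto
    then have "monom_at ?p u = 0"
      unfolding monom_at_def by (intro prod_zero) (auto simp: in_keys_iff intro!: bexI[of _ x])
    then show ?thesis using False by simp
  qed
  have "Poly_Mapping.lookup (kill_vars V f) w
      = (\<Sum>u\<in>Poly_Mapping.keys f. if u = w then (if Poly_Mapping.keys w \<subseteq> V then Poly_Mapping.lookup f w else 0) else 0)"
    unfolding kill_vars_def poly_at_def lookup_sum mon
    by (rule sum.cong) (auto simp: mono_poly_def mult_single lookup_single when_def)
  then show ?thesis by (simp add: in_keys_iff)
qed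

lemma keys_kill_vars:
  "Poly_Mapping.keys (kill_vars V f) = {w \<in> Poly_Mapping.keys f. Poly_Mapping.keys w \<subseteq> V}"
  unfolding set_eq_iff by (simp add: in_keys_iff lookup_kill_vars)

lemma kill_vars_ident: "f \<in> carrier (poly_ring V) \<Longrightarrow> kill_vars V f = f"
  by (rule poly_mapping_eqI) (auto simp: lookup_kill_vars carrier_poly_ring_iff in_keys_iff)

section \<open>Straightening modulo low rank\<close>

lemma finite_monomials_degree:
  assumes "finite V"
  shows "finite {w :: monomial. Poly_Mapping.keys w \<subseteq> V \<and> (\<Sum>x\<in>V. Poly_Mapping.lookup w x) = e}"
    (is "finite ?S")
proof (rule finite_imageD)
  have "Poly_Mapping.lookup ` ?S \<subseteq> {g. \<forall>x. (x \<in> V \<longrightarrow> g x \<in> {..e}) \<and> (x \<notin> V \<longrightarrow> g x = 0)}"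
    using assms by (auto simp: in_keys_iff intro: member_le_sum)
  then show "finite (Poly_Mapping.lookup ` ?S)"
    by (rule finite_subset) (intro finite_set_of_finite_funs assms finite_atMost)
  show "inj_on Poly_Mapping.lookup ?S" by (simp add: inj_on_def lookup_inject)
qed

lemma index_image_subsetD:
  fixes R C :: "nat \<Rightarrow> nat"
  shows "(\<lambda>a. (R a, C a)) ` {0..<r} \<subseteq> S \<Longrightarrow> a < r \<Longrightarrow> (R a, C a) \<in> S"
  by (erule subsetD, rule image_eqI[of _ _ a]) simp_all

lemma chain_factor:
  assumes "is_chain r R C" "(\<lambda>a. (R a, C a)) ` {0..<r} \<subseteq> Poly_Mapping.keys u"
  obtains b where "u = perm_monom r R C id + b"
proof -
  have inj: "inj_on R {0..<r}" using assms(1) by (auto simp: is_chain_def intro: strict_mono_on_imp_inj_on)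
  have "Poly_Mapping.lookup (perm_monom r R C id) x \<le> Poly_Mapping.lookup u x" for x
  proof (cases "x \<in> Poly_Mapping.keys (perm_monom r R C id)")
    case True
    then obtain a where "x = (R a, C a)" "a < r" by (auto simp: keys_perm_monom)
    moreover have "Poly_Mapping.lookup u x \<noteq> 0" using True assms(2) by (auto simp: keys_perm_monom in_keys_iff)
    ultimately show ?thesis by (simp add: lookup_perm_monom[OF inj])
  qed (simp add: in_keys_iff)
  then have "u = perm_monom r R C id + (u - perm_monom r R C id)"
    by (intro poly_mapping_eqI) (simp add: lookup_add lookup_minus)
  then show ?thesis using that by blast
qed

lemma keys_scale: "Poly_Mapping.keys (Poly_Mapping.single 0 c * f) \<subseteq> Poly_Mapping.keys f"
  for f :: "'k::field mpoly"
  using keys_mult[of "Poly_Mapping.single 0 c" f] by (auto split: if_splits)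

lemma keys_lincomb:
  fixes Q :: "'i \<Rightarrow> 'k::field mpoly"
  assumes "\<And>i. i \<in> S \<Longrightarrow> Poly_Mapping.keys (Q i) \<subseteq> T"
  shows "Poly_Mapping.keys (\<Sum>i\<in>S. Poly_Mapping.single 0 (c i) * Q i) \<subseteq> T"
proof (rule order.trans[OF keys_sum])
  show "(\<Union>i\<in>S. Poly_Mapping.keys (Poly_Mapping.single 0 (c i) * Q i)) \<subseteq> T"
    using assms keys_scale by blast
qed

definition standard :: "nat \<Rightarrow> (nat \<times> nat) set \<Rightarrow> monomial \<Rightarrow> bool" where
  "standard r V u \<longleftrightarrow> Poly_Mapping.keys u \<subseteq> V \<and> \<not> chain_in r (Poly_Mapping.keys u)"

text \<open>A monomial with an \<open>r\<close>-chain is the diagonal monomial of a generic minor times some \<open>b\<close>; as the minor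
  vanishes at low rank, the monomial may be replaced by the negatives of the other terms of the minor times \<open>b\<close>. They
  are smaller and have the same degree, so the process ends, and it never leaves a set \<open>T\<close> that is
  closed under these replacements.\<close>

lemma straighten:
  fixes h :: "'k::field \<Rightarrow> 'a::comm_ring_1"
  assumes h: "comm_ring_hom h" and r: "r \<ge> 1" and V: "V = {1..n} \<times> {1..m}"
    and closed: "\<And>R C \<sigma> b. is_chain r R C \<Longrightarrow> (\<lambda>a. (R a, C a)) ` {0..<r} \<subseteq> V \<Longrightarrow>
      \<sigma> permutes {0..<r} \<Longrightarrow> \<sigma> \<noteq> id \<Longrightarrow> perm_monom r R C id + b \<in> T \<Longrightarrow> perm_monom r R C \<sigma> + b \<in> T"
    and "w \<in> T" "Poly_Mapping.keys w \<subseteq> V"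
  shows "\<exists>Q :: 'k mpoly. Poly_Mapping.keys Q \<subseteq> {u \<in> T. standard r V u} \<and>
    (\<forall>A B. poly_at h (low_rank_point r A B) (Poly_Mapping.single w 1)
         = poly_at h (low_rank_point r A B) Q)"
proof -
  define deg where "deg u = (\<Sum>x\<in>V. Poly_Mapping.lookup u x)" for u :: monomial
  define below where "below u = {u'. u' < u \<and> Poly_Mapping.keys u' \<subseteq> V \<and> deg u' = deg u}" for u
  have finV: "finite V" by (simp add: V)
  have fin: "finite (below u)" for u
    by (rule finite_subset[OF _ finite_monomials_degree[OF finV, of "deg u"]]) (auto simp: below_def deg_def)
  have deg_add: "deg (u + u') = deg u + deg u'" for u u'
    by (simp add: deg_def lookup_add sum.distrib)
  show ?thesis
    using assms(5,6)
  proof (induction "card (below w)" arbitrary: w rule: less_induct)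
    case less
    show ?case
    proof (cases "chain_in r (Poly_Mapping.keys w)")
      case False
      then show ?thesis using less.prems
        by (intro exI[of _ "Poly_Mapping.single w 1"]) (auto simp: standard_def)
    next
      case True
      then obtain R C where ch: "is_chain r R C"
        and sub: "(\<lambda>a. (R a, C a)) ` {0..<r} \<subseteq> Poly_Mapping.keys w"
        by (auto simp: chain_in_def)
      obtain b where w: "w = perm_monom r R C id + b" by (rule chain_factor[OF ch sub])
      have subV: "(\<lambda>a. (R a, C a)) ` {0..<r} \<subseteq> V" using sub less.prems(2) by auto
      have bV: "Poly_Mapping.keys b \<subseteq> V" using less.prems(2) unfolding w keys_monomial_add by auto
      let ?S = "{\<sigma>. \<sigma> permutes {0..<r}}"
      have finS: "finite ?S" by (simp add: finite_permutations)
      let ?s = "\<lambda>\<sigma> :: nat \<Rightarrow> nat. of_int (sign \<sigma>) :: 'k"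
      have permV: "Poly_Mapping.keys (perm_monom r R C \<sigma>) \<subseteq> V" if "\<sigma> permutes {0..<r}" for \<sigma>
      proof -
        have "(R a, C (\<sigma> a)) \<in> V" if a: "a < r" for a
        proof -
          have "\<sigma> a < r" using permutes_in_image[OF \<open>\<sigma> permutes {0..<r}\<close>, of a] a by simp
          then have "(R a, C a) \<in> V" "(R (\<sigma> a), C (\<sigma> a)) \<in> V" using subV a by auto
          then show ?thesis by (auto simp: V)
        qed
        then show ?thesis by (auto simp: keys_perm_monom)
      qed
      have degp: "deg (perm_monom r R C \<sigma>) = r" if "\<sigma> permutes {0..<r}" for \<sigma>
      proof -
        have "deg (perm_monom r R C \<sigma>) = (\<Sum>a = 0..<r. \<Sum>x\<in>V. Poly_Mapping.lookup (Poly_Mapping.single (R a, C (\<sigma> a)) 1) x)"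
          unfolding deg_def perm_monom_def lookup_sum by (rule sum.swap)
        also have "\<dots> = (\<Sum>a = 0..<r. 1)"
          by (rule sum.cong) (use permV[OF that] finV in \<open>auto simp: keys_perm_monom lookup_single when_def\<close>)
        finally show ?thesis by simp
      qed
      have "\<exists>Q :: 'k mpoly. Poly_Mapping.keys Q \<subseteq> {u \<in> T. standard r V u} \<and>
          (\<forall>A B. poly_at h (low_rank_point r A B) (Poly_Mapping.single (perm_monom r R C \<sigma> + b) 1)
               = poly_at h (low_rank_point r A B) Q)"
        if \<sigma>: "\<sigma> \<in> ?S - {id}" for \<sigma>
      proof (rule less.hyps)
        let ?w = "perm_monom r R C \<sigma> + b"
        have lt: "?w < w" unfolding w using \<sigma> by (intro add_strict_right_mono perm_monom_less ch) auto
        show wV: "Poly_Mapping.keys ?w \<subseteq> V" using permV bV \<sigma> by (auto simp: keys_monomial_add)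
        have "deg ?w = deg w" using \<sigma> by (simp add: w deg_add degp permutes_id)
        then have "below ?w \<subset> below w" using lt wV by (auto simp: below_def)
        then show "card (below ?w) < card (below w)" by (intro psubset_card_mono fin)
        show "?w \<in> T" using closed[OF ch subV, of \<sigma> b] \<sigma> less.prems(1) w by auto
      qed
      then have "\<forall>\<sigma>\<in>?S - {id}. \<exists>Q :: 'k mpoly. Poly_Mapping.keys Q \<subseteq> {u \<in> T. standard r V u} \<and>
          (\<forall>A B. poly_at h (low_rank_point r A B) (Poly_Mapping.single (perm_monom r R C \<sigma> + b) 1)
               = poly_at h (low_rank_point r A B) Q)"
        by (rule ballI)
      from bchoice[OF this] obtain Q :: "(nat \<Rightarrow> nat) \<Rightarrow> 'k mpoly" where
        Qk: "\<And>\<sigma>. \<sigma> \<in> ?S - {id} \<Longrightarrow> Poly_Mapping.keys (Q \<sigma>) \<subseteq> {u \<in> T. standard r V u}" and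
        Q: "\<And>\<sigma> A B. \<sigma> \<in> ?S - {id} \<Longrightarrow>
          poly_at h (low_rank_point r A B) (Poly_Mapping.single (perm_monom r R C \<sigma> + b) 1)
               = poly_at h (low_rank_point r A B) (Q \<sigma>)"
        by blast
      let ?Q = "\<Sum>\<sigma>\<in>?S - {id}. Poly_Mapping.single 0 (- ?s \<sigma>) * Q \<sigma>"
      have "poly_at h p (Poly_Mapping.single w 1) = poly_at h p ?Q"
        if p: "p = low_rank_point r A B" for p A B
      proof -
        interpret h: comm_ring_hom h by (rule h)
        let ?M = "\<lambda>\<sigma>. monom_at p (perm_monom r R C \<sigma> + b)"
        have "0 = poly_at h p (gen_minor r R C) * monom_at p b"
          unfolding p by (simp only: gen_minor_vanishes[OF h r] mult_zero_left)
        also have "\<dots> = (\<Sum>\<sigma>\<in>?S. h (?s \<sigma>) * ?M \<sigma>)"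
          by (simp only: gen_minor_expand poly_at_sum[OF h] poly_at_single[OF h] sum_distrib_right
              monom_at_add mult.assoc)
        also have "\<dots> = h (?s id) * ?M id + (\<Sum>\<sigma>\<in>?S - {id}. h (?s \<sigma>) * ?M \<sigma>)"
          by (rule sum.remove[of ?S id "\<lambda>\<sigma>. h (?s \<sigma>) * ?M \<sigma>"]) (simp_all add: finS permutes_id)
        also have "h (?s id) * ?M id = monom_at p w"
          by (simp only: sign_id of_int_1 h.hom_one mult_1 w)
        finally have "monom_at p w = - (\<Sum>\<sigma>\<in>?S - {id}. h (?s \<sigma>) * ?M \<sigma>)"
          unfolding eq_neg_iff_add_eq_0 by (rule sym)
        then have "poly_at h p (Poly_Mapping.single w 1) = (\<Sum>\<sigma>\<in>?S - {id}. h (- ?s \<sigma>) * ?M \<sigma>)"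
          by (simp only: poly_at_single[OF h] h.hom_one mult_1 h.hom_uminus mult_minus_left sum_negf)
        also have "\<dots> = (\<Sum>\<sigma>\<in>?S - {id}. h (- ?s \<sigma>) * poly_at h p (Q \<sigma>))"
        proof (rule sum.cong)
          fix \<sigma> assume "\<sigma> \<in> ?S - {id}"
          from Q[OF this, of A B] show "h (- ?s \<sigma>) * ?M \<sigma> = h (- ?s \<sigma>) * poly_at h p (Q \<sigma>)"
            by (simp only: poly_at_single[OF h] p h.hom_one mult_1)
        qed simp
        also have "\<dots> = poly_at h p ?Q"
          by (simp only: poly_at_sum[OF h] poly_at_mult[OF h] poly_at_single[OF h] monom_at_def
              keys_zero prod.empty mult_1_right)
        finally show ?thesis .
      qed
      moreover have "Poly_Mapping.keys ?Q \<subseteq> {u \<in> T. standard r V u}"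
        by (rule keys_lincomb) (rule Qk)
      ultimately show ?thesis by blast
    qed
  qed
qed

section \<open>Minors that meet the ladders\<close>

text \<open>The next two facts are pigeonhole arguments: a permutation cannot map the indices from \<open>a\<close> on into those
  beyond \<open>a\<close>, nor the indices up to \<open>a\<close> into those before \<open>a\<close>.\<close>

lemma permutes_hits_lower_left:
  fixes \<sigma> :: "nat \<Rightarrow> nat"
  assumes \<sigma>: "\<sigma> permutes {0..<r}" and a: "a < r"
  shows "\<exists>b. a \<le> b \<and> b < r \<and> \<sigma> b \<le> a"
proof (rule ccontr)
  assume none: "\<nexists>b. a \<le> b \<and> b < r \<and> \<sigma> b \<le> a"
  have "a < \<sigma> b" if "a \<le> b" "b < r" for b
  proof -
    have "\<not> \<sigma> b \<le> a" using none that by blast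
    then show ?thesis by simp
  qed
  moreover have "\<And>b. b < r \<Longrightarrow> \<sigma> b < r" using permutes_in_image[OF \<sigma>] by auto
  ultimately have "\<sigma> ` {a..<r} \<subseteq> {Suc a..<r}" by (auto simp: Suc_le_eq)
  then have "card (\<sigma> ` {a..<r}) \<le> card {Suc a..<r}" by (intro card_mono) auto
  moreover have "card (\<sigma> ` {a..<r}) = card {a..<r}"
    by (intro card_image inj_on_subset[OF permutes_inj[OF \<sigma>]]) auto
  ultimately show False using a by simp
qed

lemma permutes_hits_upper_right:
  fixes \<sigma> :: "nat \<Rightarrow> nat"
  assumes \<sigma>: "\<sigma> permutes {0..<r}" and a: "a < r"
  shows "\<exists>b. b \<le> a \<and> a \<le> \<sigma> b"
proof (rule ccontr)
  assume none: "\<nexists>b. b \<le> a \<and> a \<le> \<sigma> b"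
  have "\<sigma> b < a" if "b \<le> a" for b
  proof -
    have "\<not> a \<le> \<sigma> b" using none that by blast
    then show ?thesis by simp
  qed
  then have "\<sigma> ` {0..a} \<subseteq> {0..<a}" by auto
  then have "card (\<sigma> ` {0..a}) \<le> card {0..<a}" by (intro card_mono) auto
  moreover have "card (\<sigma> ` {0..a}) = card {0..a}"
    by (intro card_image inj_on_subset[OF permutes_inj[OF \<sigma>]]) auto
  ultimately show False by simp
qed

lemma lower_ladder_closed:
  assumes "gd_shape n m s c t d" "(i, j) \<in> lower_ladder n s c" "i \<le> i'" "i' \<le> n" "1 \<le> j'" "j' \<le> j"
  shows "(i', j') \<in> lower_ladder n s c"
proof -
  have "1 \<le> j" "j \<le> s" "n - c j < i" using assms(2) by (auto simp: lower_ladder_def)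
  moreover have "c j \<le> c j'" using assms \<open>j \<le> s\<close> by (auto simp: gd_shape_def)
  ultimately show ?thesis using assms by (auto simp: lower_ladder_def)
qed

lemma upper_ladder_closed:
  assumes "gd_shape n m s c t d" "(i, j) \<in> upper_ladder m t d" "1 \<le> i'" "i' \<le> i" "j \<le> j'" "j' \<le> m"
  shows "(i', j') \<in> upper_ladder m t d"
proof -
  have "t \<le> j" "j \<le> m" "i \<le> d j" using assms(2) by (auto simp: upper_ladder_def)
  moreover have "d j \<le> d j'" using assms \<open>t \<le> j\<close> by (auto simp: gd_shape_def)
  ultimately show ?thesis using assms by (auto simp: upper_ladder_def)
qed

text \<open>The lower ladder is closed under moving down and left, the upper one under moving up and right. If
  the diagonal of a minor meets a ladder, any other term has a factor in that direction from the
  meeting point, hence in the same ladder.\<close>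

lemma diagonal_zero_imp_term_zero:
  assumes gd: "gd_shape n m s c t d" and ch: "is_chain r R C"
    and sub: "(\<lambda>a. (R a, C a)) ` {0..<r} \<subseteq> {1..n} \<times> {1..m}" and \<sigma>: "\<sigma> permutes {0..<r}"
    and zero: "\<not> Poly_Mapping.keys (perm_monom r R C id) \<subseteq> gd_vars n m s c t d"
  shows "\<not> Poly_Mapping.keys (perm_monom r R C \<sigma>) \<subseteq> gd_vars n m s c t d"
proof -
  have R: "R a \<le> R b" and C: "C a \<le> C b" if "a \<le> b" "b < r" for a b
    using ch that by (auto simp: is_chain_def dest!: strict_mono_on_imp_mono_on intro: mono_onD)
  have rg: "1 \<le> R a" "R a \<le> n" "1 \<le> C a" "C a \<le> m" if "a < r" for a
    using index_image_subsetD[OF sub that] by auto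
  have sr: "\<sigma> b < r" if "b < r" for b using permutes_in_image[OF \<sigma>] that by auto
  obtain a where a: "a < r" and "(R a, C a) \<notin> gd_vars n m s c t d"
    using zero by (auto simp: keys_perm_monom image_subset_iff)
  then have "(R a, C a) \<in> lower_ladder n s c \<or> (R a, C a) \<in> upper_ladder m t d"
    using rg[OF a] by (auto simp: gd_vars_def)
  then obtain b where "b < r" "(R b, C (\<sigma> b)) \<in> lower_ladder n s c \<union> upper_ladder m t d"
  proof
    assume L: "(R a, C a) \<in> lower_ladder n s c"
    obtain b where b: "a \<le> b" "b < r" "\<sigma> b \<le> a" using permutes_hits_lower_left[OF \<sigma> a] by auto
    have "(R b, C (\<sigma> b)) \<in> lower_ladder n s c"
      by (rule lower_ladder_closed[OF gd L]) (use R C rg sr b a in auto)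
    then show thesis using that b by blast
  next
    assume L: "(R a, C a) \<in> upper_ladder m t d"
    obtain b where b: "b \<le> a" "a \<le> \<sigma> b" using permutes_hits_upper_right[OF \<sigma> a] by auto
    then have "b < r" using a by simp
    have "(R b, C (\<sigma> b)) \<in> upper_ladder m t d"
      by (rule upper_ladder_closed[OF gd L]) (use R C rg sr b a \<open>b < r\<close> in auto)
    then show thesis using that \<open>b < r\<close> by blast
  qed
  moreover have "(R b, C (\<sigma> b)) \<in> Poly_Mapping.keys (perm_monom r R C \<sigma>)"
    unfolding keys_perm_monom by (rule image_eqI[of _ _ b]) (simp_all add: \<open>b < r\<close>)
  ultimately show ?thesis by (auto simp: gd_vars_def)
qed

lemma kill_vars_indet: "kill_vars V (indet x) = (if x \<in> V then indet x else 0)"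
  unfolding kill_vars_def by (rule poly_at_indet[OF single_zero_hom])

lemma kill_vars_gen_minor:
  "kill_vars V (gen_minor r R C :: 'k::field mpoly) = det (mat r r (\<lambda>(a, b). if (R a, C b) \<in> V then indet (R a, C b) else 0))"
proof -
  interpret k: comm_ring_hom "kill_vars V :: 'k mpoly \<Rightarrow> 'k mpoly" by (rule kill_vars_hom)
  have "kill_vars V (gen_minor r R C :: 'k mpoly)
      = det (map_mat (kill_vars V) (mat r r (\<lambda>(a, b). indet (R a, C b))))"
    unfolding gen_minor_def by (rule k.hom_det[symmetric])
  also have "map_mat (kill_vars V) (mat r r (\<lambda>(a, b). indet (R a, C b) :: 'k mpoly))
      = mat r r (\<lambda>(a, b). if (R a, C b) \<in> V then indet (R a, C b) else 0)"
    by (rule eq_matI) (auto simp: kill_vars_indet)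
  finally show ?thesis .
qed

lemma det_submatrix_gd_matrix:
  assumes "I \<subseteq> {..<n}" "J \<subseteq> {..<m}" "card I = r" "card J = r"
  shows "det (submatrix (gd_matrix n m s c t d :: 'k::field mpoly mat) I J)
    = kill_vars (gd_vars n m s c t d) (gen_minor r (\<lambda>a. pick I a + 1) (\<lambda>b. pick J b + 1))"
proof -
  have IJ: "{i. i < n \<and> i \<in> I} = I" "{j. j < m \<and> j \<in> J} = J" using assms by auto
  have "pick I a < n" "pick J a < m" if "a < r" for a
    using that assms pick_in_set_le[of a I] pick_in_set_le[of a J] by auto
  then have "submatrix (gd_matrix n m s c t d :: 'k mpoly mat) I J = mat r r (\<lambda>(a, b).
      if (pick I a + 1, pick J b + 1) \<in> gd_vars n m s c t d then indet (pick I a + 1, pick J b + 1) else 0)"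
    unfolding submatrix_def
    by (intro eq_matI) (auto simp: gd_matrix_def IJ assms gd_vars_def Suc_le_eq)
  then show ?thesis by (simp only: kill_vars_gen_minor)
qed

lemma pick_image_strict_mono:
  assumes "strict_mono_on {0..<r} F" "a < r"
  shows "pick (F ` {0..<r}) a = F a"
proof -
  have "{x \<in> F ` {0..<r}. x < F a} = F ` {0..<a}"
    using assms by (auto simp: strict_mono_on_less)
  moreover have "card (F ` {0..<a}) = a"
    using assms by (subst card_image) (auto intro: inj_on_subset[OF strict_mono_on_imp_inj_on])
  ultimately show ?thesis using pick_card_in_set[of "F a" "F ` {0..<r}"] assms(2) by simp
qed

lemma chain_minor_in_minors:
  assumes ch: "is_chain r R C" and sub: "(\<lambda>a. (R a, C a)) ` {0..<r} \<subseteq> {1..n} \<times> {1..m}"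
  shows "kill_vars (gd_vars n m s c t d) (gen_minor r R C :: 'k::field mpoly)
    \<in> minors r (gd_matrix n m s c t d)"
proof -
  define I where "I = (\<lambda>a. R a - 1) ` {0..<r}"
  define J where "J = (\<lambda>a. C a - 1) ` {0..<r}"
  have rg: "1 \<le> R a" "R a \<le> n" "1 \<le> C a" "C a \<le> m" if "a < r" for a
    using index_image_subsetD[OF sub that] by auto
  have mono: "strict_mono_on {0..<r} (\<lambda>a. R a - 1)" "strict_mono_on {0..<r} (\<lambda>a. C a - 1)"
    using ch rg unfolding is_chain_def strict_mono_on_def
    by (metis atLeastLessThan_iff diff_less_mono)+
  have IJ: "I \<subseteq> {..<n}" "J \<subseteq> {..<m}" using rg by (force simp: I_def J_def)+
  have card: "card I = r" "card J = r"
    unfolding I_def J_def using mono by (simp_all add: card_image strict_mono_on_imp_inj_on)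
  have p: "Suc (pick I a) = R a" "Suc (pick J a) = C a" if "a < r" for a
    using pick_image_strict_mono[OF mono(1) that] pick_image_strict_mono[OF mono(2) that] rg[OF that]
    unfolding I_def J_def by linarith+
  have "gen_minor r (\<lambda>a. pick I a + 1) (\<lambda>b. pick J b + 1) = (gen_minor r R C :: 'k mpoly)"
    unfolding gen_minor_def by (rule arg_cong[where f = det], rule cong_mat) (simp_all add: p)
  then have "det (submatrix (gd_matrix n m s c t d) I J)
      = kill_vars (gd_vars n m s c t d) (gen_minor r R C :: 'k mpoly)"
    by (simp only: det_submatrix_gd_matrix[OF IJ card])
  moreover have "I \<subseteq> {..<dim_row (gd_matrix n m s c t d)}" "J \<subseteq> {..<dim_col (gd_matrix n m s c t d)}"
    using IJ by (simp_all add: gd_matrix_def)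
  ultimately show ?thesis
    unfolding minors_def mem_Collect_eq using card by (intro exI[of _ I] exI[of _ J] conjI) simp_all
qed

lemma lead_kill_vars_gen_minor:
  assumes ch: "is_chain r R C" and sub: "(\<lambda>a. (R a, C a)) ` {0..<r} \<subseteq> V"
  shows "kill_vars V (gen_minor r R C :: 'k::field mpoly) \<noteq> 0"
    and "lead_monom (kill_vars V (gen_minor r R C :: 'k mpoly)) = perm_monom r R C id"
proof -
  let ?g = "kill_vars V (gen_minor r R C) :: 'k mpoly"
  have key: "perm_monom r R C id \<in> Poly_Mapping.keys ?g"
    using sub gen_minor_lead[OF ch, where 'k = 'k] by (auto simp: in_keys_iff lookup_kill_vars keys_perm_monom)
  then show "?g \<noteq> 0" by auto
  have "u \<le> perm_monom r R C id" if "u \<in> Poly_Mapping.keys ?g" for u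
    using that keys_gen_minor[of r R C, where 'k = 'k] perm_monom_less[OF ch]
    by (fastforce simp: keys_kill_vars)
  then show "lead_monom ?g = perm_monom r R C id"
    unfolding lead_monom_def using key by (intro Max_eqI) auto
qed

section \<open>Leading monomials in the ideal of minors\<close>

text \<open>An ideal that contains the minors of the matrix with zeros, hence the ideal they generate. Its purpose
  is that every element comes with a lift to all the variables \<open>W\<close> that vanishes at low rank.\<close>

definition vanishing_shadow ::
  "('k::field \<Rightarrow> 'a::comm_ring_1) \<Rightarrow> nat \<Rightarrow> (nat \<times> nat) set \<Rightarrow> (nat \<times> nat) set \<Rightarrow> 'k mpoly set" where
  "vanishing_shadow h r W V = {kill_vars V F | F. F \<in> carrier (poly_ring W) \<and>
     (\<forall>A B. poly_at h (low_rank_point r A B) F = 0)}"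

lemma ideal_vanishing_shadow:
  assumes h: "comm_ring_hom h" and sub: "V \<subseteq> W"
  shows "ideal (vanishing_shadow h r W V) (poly_ring V)"
proof -
  interpret V: cring "poly_ring V" by (rule cring_poly_ring)
  interpret W: cring "poly_ring W" by (rule cring_poly_ring)
  interpret k: comm_ring_hom "kill_vars V :: 'a mpoly \<Rightarrow> 'a mpoly" by (rule kill_vars_hom)
  have VW: "a \<in> carrier (poly_ring W)" if "a \<in> carrier (poly_ring V)" for a :: "'a mpoly"
    using that sub by (auto simp: carrier_poly_ring_iff)
  have carr: "vanishing_shadow h r W V \<subseteq> carrier (poly_ring V)"
    by (auto simp: vanishing_shadow_def carrier_poly_ring_iff keys_kill_vars)
  have mult: "a * f \<in> vanishing_shadow h r W V"
    if f: "f \<in> vanishing_shadow h r W V" and a: "a \<in> carrier (poly_ring V)" for a f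
  proof -
    obtain F where F: "f = kill_vars V F" "F \<in> carrier (poly_ring W)"
      "\<And>A B. poly_at h (low_rank_point r A B) F = 0"
      using f by (auto simp: vanishing_shadow_def)
    have "a * f = kill_vars V (a * F)" by (simp add: k.hom_mult F(1) kill_vars_ident[OF a])
    moreover have "a * F \<in> carrier (poly_ring W)" using W.m_closed[OF VW[OF a] F(2)] by simp
    ultimately show ?thesis using F(3) poly_at_mult[OF h] by (auto simp: vanishing_shadow_def)
  qed
  have add: "f + g \<in> vanishing_shadow h r W V"
    if f: "f \<in> vanishing_shadow h r W V" and g: "g \<in> vanishing_shadow h r W V" for f g
  proof -
    obtain F where F: "f = kill_vars V F" "F \<in> carrier (poly_ring W)"
      "\<And>A B. poly_at h (low_rank_point r A B) F = 0"
      using f by (auto simp: vanishing_shadow_def)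
    obtain G where G: "g = kill_vars V G" "G \<in> carrier (poly_ring W)"
      "\<And>A B. poly_at h (low_rank_point r A B) G = 0"
      using g by (auto simp: vanishing_shadow_def)
    have "f + g = kill_vars V (F + G)" by (simp add: k.hom_add F(1) G(1))
    moreover have "F + G \<in> carrier (poly_ring W)" using W.a_closed[OF F(2) G(2)] by simp
    ultimately show ?thesis using F(3) G(3) poly_at_add[OF h] by (auto simp: vanishing_shadow_def)
  qed
  have zero: "0 \<in> vanishing_shadow h r W V"
    unfolding vanishing_shadow_def using W.zero_closed poly_at_zero[OF h] k.hom_zero
    by (auto intro!: exI[of _ 0])
  have uminus: "- f \<in> vanishing_shadow h r W V" if "f \<in> vanishing_shadow h r W V" for f
    using mult[OF that, of "- 1"] by (simp add: carrier_poly_ring_iff)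
  show ?thesis
  proof (rule idealI)
    show "ring (poly_ring V :: 'a mpoly ring)" by (rule V.ring_axioms)
    show "subgroup (vanishing_shadow h r W V) (add_monoid (poly_ring V))"
    proof (rule subgroup.intro)
      show "inv\<^bsub>add_monoid (poly_ring V)\<^esub> f \<in> vanishing_shadow h r W V"
        if "f \<in> vanishing_shadow h r W V" for f
        using uminus[OF that] a_inv_poly_ring[of f V] that carr by (auto simp: a_inv_def)
    qed (use carr add zero in auto)
  qed (use mult in \<open>auto simp: mult.commute\<close>)
qed

text \<open>Suppose the leading monomial \<open>u\<close> of \<open>f\<close> has no \<open>r\<close>-chain, and lift \<open>f\<close> to a polynomial \<open>F\<close> in
  all variables that vanishes at low rank. Every monomial of \<open>F\<close> other than \<open>u\<close> lies in the set \<open>T\<close> of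
  monomials that involve a ladder variable or are smaller than \<open>u\<close>. Straightening stays inside \<open>T\<close>: in
  the first case because all terms of a minor meet the ladders if its diagonal does, in the second
  because terms get smaller. So the coefficient of \<open>u\<close> survives, and the result is a nonzero
  polynomial that vanishes at low rank and has no monomial with an \<open>r\<close>-chain. Its leading monomial
  contradicts the generic case.\<close>

lemma gd_lead_has_chain:
  fixes f :: "'k::field mpoly" and h :: "'k \<Rightarrow> 'a::field"
  assumes gd: "gd_shape n m s c t d" and h: "comm_ring_hom h" and inf: "infinite (UNIV :: 'a set)"
    and r: "r \<ge> 1"
    and f: "f \<in> vanishing_shadow h r ({1..n} \<times> {1..m}) (gd_vars n m s c t d)" "f \<noteq> 0"
  shows "chain_in r (Poly_Mapping.keys (lead_monom f))"
proof (rule ccontr)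
  define V where "V = gd_vars n m s c t d"
  define W where "W = {1..n} \<times> {1..m}"
  define u where "u = lead_monom f"
  assume "\<not> ?thesis"
  then have nch: "\<not> chain_in r (Poly_Mapping.keys u)" by (simp add: u_def)
  obtain F where F: "f = kill_vars V F" "F \<in> carrier (poly_ring W)"
      "\<And>A B. poly_at h (low_rank_point r A B) F = 0"
    using f(1) by (auto simp: vanishing_shadow_def V_def W_def)
  have uf: "u \<in> Poly_Mapping.keys f" unfolding u_def lead_monom_def using f(2) by (intro Max_in) auto
  then have uF: "u \<in> Poly_Mapping.keys F" and uV: "Poly_Mapping.keys u \<subseteq> V"
    by (auto simp: F(1) keys_kill_vars)
  have FW: "Poly_Mapping.keys w \<subseteq> W" if "w \<in> Poly_Mapping.keys F" for w
    using F(2) that by (auto simp: carrier_poly_ring_iff)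
  define T where "T = {w. \<not> Poly_Mapping.keys w \<subseteq> V \<or> w < u}"
  have closed: "perm_monom r R C \<sigma> + b \<in> T"
    if "is_chain r R C" "(\<lambda>a. (R a, C a)) ` {0..<r} \<subseteq> W" "\<sigma> permutes {0..<r}" "\<sigma> \<noteq> id"
      "perm_monom r R C id + b \<in> T" for R C \<sigma> b
  proof -
    have "perm_monom r R C \<sigma> + b < perm_monom r R C id + b"
      using that by (intro add_strict_right_mono perm_monom_less)
    then have "perm_monom r R C \<sigma> + b < u" if "perm_monom r R C id + b < u"
      using that by (rule order.strict_trans)
    then show ?thesis
      using that(5) diagonal_zero_imp_term_zero[OF gd that(1) that(2)[unfolded W_def] that(3)]
      by (auto simp: T_def keys_monomial_add V_def)
  qed
  have inT: "w \<in> T" if w: "w \<in> Poly_Mapping.keys F - {u}" for w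
  proof (cases "Poly_Mapping.keys w \<subseteq> V")
    case True
    then have "w \<in> Poly_Mapping.keys f" using w by (simp add: F(1) keys_kill_vars)
    then have "w \<le> u" by (simp add: u_def lead_monom_def)
    then show ?thesis using w by (auto simp: T_def)
  qed (simp add: T_def)
  have "\<exists>Q :: 'k mpoly. Poly_Mapping.keys Q \<subseteq> {u \<in> T. standard r W u} \<and>
    (\<forall>A B. poly_at h (low_rank_point r A B) (Poly_Mapping.single w 1)
         = poly_at h (low_rank_point r A B) Q)"
    if w: "w \<in> Poly_Mapping.keys F - {u}" for w
    by (rule straighten[OF h r W_def closed inT[OF w]]) (use FW w in auto)
  then have "\<forall>w\<in>Poly_Mapping.keys F - {u}. \<exists>Q :: 'k mpoly. Poly_Mapping.keys Q \<subseteq> {u \<in> T. standard r W u} \<and>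
    (\<forall>A B. poly_at h (low_rank_point r A B) (Poly_Mapping.single w 1)
         = poly_at h (low_rank_point r A B) Q)"
    by (rule ballI)
  from bchoice[OF this] obtain Q :: "monomial \<Rightarrow> 'k mpoly" where
    Qk: "\<And>w. w \<in> Poly_Mapping.keys F - {u} \<Longrightarrow> Poly_Mapping.keys (Q w) \<subseteq> {u \<in> T. standard r W u}" and
    Q: "\<And>w A B. w \<in> Poly_Mapping.keys F - {u} \<Longrightarrow>
      poly_at h (low_rank_point r A B) (Poly_Mapping.single w 1)
         = poly_at h (low_rank_point r A B) (Q w)"
    by blast
  let ?c = "Poly_Mapping.lookup F"
  define H where "H = (\<Sum>w\<in>Poly_Mapping.keys F - {u}. Poly_Mapping.single 0 (?c w) * Q w)"
  define G where "G = Poly_Mapping.single u (?c u) + H"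
  have Hk: "Poly_Mapping.keys H \<subseteq> {u \<in> T. standard r W u}"
    unfolding H_def by (rule keys_lincomb) (rule Qk)
  have uT: "u \<notin> T" using uV by (simp add: T_def)
  have "Poly_Mapping.lookup H u = 0" using Hk uT by (auto simp: in_keys_iff)
  then have "Poly_Mapping.lookup G u \<noteq> 0" using uF by (simp add: G_def lookup_add in_keys_iff)
  then have G0: "G \<noteq> 0" by auto
  have "standard r W u" using nch FW[OF uF] by (simp add: standard_def)
  then have Gk: "standard r W w" if "w \<in> Poly_Mapping.keys G" for w
    using that Hk Poly_Mapping.keys_add[of "Poly_Mapping.single u (?c u)" H]
    by (auto simp: G_def split: if_splits)
  have "chain_in r (Poly_Mapping.keys (lead_monom G))"
  proof (rule lead_monom_has_chain[OF h inf r W_def _ G0])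
    show "G \<in> carrier (poly_ring W)" using Gk by (auto simp: carrier_poly_ring_iff standard_def)
    fix A B :: "nat \<Rightarrow> nat \<Rightarrow> 'a"
    let ?p = "low_rank_point r A B"
    interpret h: comm_ring_hom h by (rule h)
    have "poly_at h ?p G = h (?c u) * monom_at ?p u
        + (\<Sum>w\<in>Poly_Mapping.keys F - {u}. h (?c w) * poly_at h ?p (Q w))"
      by (simp add: G_def H_def poly_at_add[OF h] poly_at_sum[OF h] poly_at_mult[OF h] poly_at_single[OF h] monom_at_def)
    also have "(\<Sum>w\<in>Poly_Mapping.keys F - {u}. h (?c w) * poly_at h ?p (Q w))
        = (\<Sum>w\<in>Poly_Mapping.keys F - {u}. h (?c w) * monom_at ?p w)"
    proof (rule sum.cong)
      fix w assume "w \<in> Poly_Mapping.keys F - {u}"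
      from Q[OF this, of A B] show "h (?c w) * poly_at h ?p (Q w) = h (?c w) * monom_at ?p w"
        by (simp add: poly_at_single[OF h])
    qed simp
    also have "h (?c u) * monom_at ?p u + \<dots> = poly_at h ?p F"
      unfolding poly_at_def[of h ?p F] using uF by (subst sum.remove[of _ u]) auto
    finally show "poly_at h ?p G = 0" using F(3) by simp
  qed
  moreover have "lead_monom G \<in> Poly_Mapping.keys G"
    unfolding lead_monom_def using G0 by (intro Max_in) auto
  ultimately show False using Gk by (auto simp: standard_def)
qed

text \<open>Laurent series serve as an infinite field that contains the given, possibly finite, one.\<close>

lemma fls_const_hom: "comm_ring_hom (fls_const :: 'k::field \<Rightarrow> 'k fls)"
  by unfold_locales (simp_all only: fls_plus_const fls_const_mult_const fls_const_0 fls_const_1)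

lemma infinite_fls: "infinite (UNIV :: 'k::field fls set)"
proof -
  have "inj (\<lambda>i. fls_X_intpow i :: 'k fls)"
    by (rule injI) (metis fls_subdegree_fls_X_intpow)
  then have "infinite (range (\<lambda>i. fls_X_intpow i :: 'k fls))"
    using finite_imageD infinite_UNIV_int by blast
  then show ?thesis using finite_subset subset_UNIV by blast
qed

theorem proposition2p3:
  fixes n m s t r :: nat and c d :: "nat \<Rightarrow> nat"
    and X :: "'k::field mpoly mat"
  assumes "gd_shape n m s c t d"
    and "X = gd_matrix n m s c t d"
    and "r \<ge> 1"
  shows "groebner_basis (gd_vars n m s c t d) (minors r X)
           (minor_ideal (gd_vars n m s c t d) r X)"
proof -
  define V where "V = gd_vars n m s c t d"
  define W where "W = {1..n} \<times> {1..m}"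
  define N where "N = vanishing_shadow (fls_const :: 'k \<Rightarrow> 'k fls) r W V"
  interpret cring "poly_ring V :: 'k mpoly ring" by (rule cring_poly_ring)
  have VW: "V \<subseteq> W" by (auto simp: V_def W_def gd_vars_def)
  have dims: "dim_row X = n" "dim_col X = m" by (simp_all add: assms(2) gd_matrix_def)
  have N: "ideal N (poly_ring V)" unfolding N_def by (rule ideal_vanishing_shadow[OF fls_const_hom VW])
  have NV: "N \<subseteq> carrier (poly_ring V)" using N by (rule ideal.Icarr[THEN subsetI])
  have fin: "finite (minors r X)"
  proof -
    have "minors r X \<subseteq> (\<lambda>(I, J). det (submatrix X I J)) ` (Pow {..<n} \<times> Pow {..<m})"
      by (auto simp: minors_def dims)
    then show ?thesis by (rule finite_subset) simp
  qed
  have minN: "minors r X \<subseteq> N"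
  proof
    fix g assume "g \<in> minors r X"
    then obtain I J where IJ: "I \<subseteq> {..<n}" "J \<subseteq> {..<m}" "card I = r" "card J = r"
      and g: "g = det (submatrix X I J)" by (auto simp: minors_def dims)
    let ?R = "\<lambda>a. pick I a + 1" and ?C = "\<lambda>b. pick J b + 1"
    have "g = kill_vars V (gen_minor r ?R ?C)"
      unfolding g assms(2) V_def by (rule det_submatrix_gd_matrix[OF IJ])
    moreover have "gen_minor r ?R ?C \<in> carrier (poly_ring W :: 'k mpoly ring)"
    proof -
      have "?R a \<in> {1..n}" "?C a \<in> {1..m}" if "a < r" for a
        using that IJ pick_in_set_le[of a I] pick_in_set_le[of a J] by (auto simp: Suc_le_eq)
      moreover have "\<sigma> a < r" if "\<sigma> permutes {0..<r}" "a < r" for \<sigma> a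
        using permutes_in_image[OF that(1), of a] that(2) by simp
      ultimately show ?thesis
        using keys_gen_minor[of r ?R ?C, where 'k = 'k]
        by (force simp: carrier_poly_ring_iff keys_perm_monom W_def)
    qed
    ultimately show "g \<in> N"
      unfolding N_def vanishing_shadow_def using gen_minor_vanishes[OF fls_const_hom assms(3)] by blast
  qed
  have minV: "minors r X \<subseteq> carrier (poly_ring V)" using minN NV by blast
  have sub: "minors r X \<subseteq> minor_ideal V r X"
    unfolding minor_ideal_def by (rule genideal_self[OF minV])
  have idN: "minor_ideal V r X \<subseteq> N"
    unfolding minor_ideal_def by (rule genideal_minimal[OF N minN])
  let ?L = "\<lambda>G. {mono_poly (lead_monom f) | f. f \<in> G \<and> f \<noteq> (0 :: 'k mpoly)}"
  have lead_keys: "Poly_Mapping.keys (lead_monom f) \<subseteq> V" if "f \<in> carrier (poly_ring V)" "f \<noteq> 0"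
    for f :: "'k mpoly"
  proof -
    have "lead_monom f \<in> Poly_Mapping.keys f" unfolding lead_monom_def using that(2) by (intro Max_in) auto
    then show ?thesis using that(1) by (auto simp: carrier_poly_ring_iff)
  qed
  have Lc: "?L G \<subseteq> carrier (poly_ring V)" if "G \<subseteq> N" for G
  proof
    fix x assume "x \<in> ?L G"
    then obtain f where f: "f \<in> G" "f \<noteq> 0" "x = mono_poly (lead_monom f)" by auto
    then have "Poly_Mapping.keys (lead_monom f) \<subseteq> V" using lead_keys[of f] that NV by blast
    then show "x \<in> carrier (poly_ring V)" by (simp add: f(3) carrier_poly_ring_iff mono_poly_def)
  qed
  interpret ini: ideal "initial_ideal V (minors r X)" "poly_ring V"
    unfolding initial_ideal_def by (rule genideal_ideal[OF Lc[OF minN]])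
  have ini_gen: "?L (minors r X) \<subseteq> initial_ideal V (minors r X)"
    unfolding initial_ideal_def by (rule genideal_self[OF Lc[OF minN]])
  have "initial_ideal V (minors r X) \<subseteq> initial_ideal V (minor_ideal V r X)"
  proof -
    have "ideal (initial_ideal V (minor_ideal V r X)) (poly_ring V)"
      unfolding initial_ideal_def by (rule genideal_ideal[OF Lc[OF idN]])
    moreover have "?L (minors r X) \<subseteq> initial_ideal V (minor_ideal V r X)"
      using genideal_self[OF Lc[OF idN]] sub unfolding initial_ideal_def by blast
    ultimately show ?thesis
      unfolding initial_ideal_def[of V "minors r X"] by (rule genideal_minimal)
  qed
  moreover have "initial_ideal V (minor_ideal V r X) \<subseteq> initial_ideal V (minors r X)"
    unfolding initial_ideal_def[of V "minor_ideal V r X"]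
  proof (rule genideal_minimal[OF ini.ideal_axioms], rule subsetI)
    fix x :: "'k mpoly" assume "x \<in> ?L (minor_ideal V r X)"
    then obtain f where f: "f \<in> N" "f \<noteq> 0" and x: "x = mono_poly (lead_monom f)" using idN by auto
    have leadV: "Poly_Mapping.keys (lead_monom f) \<subseteq> V" using lead_keys[of f] f NV by auto
    have "chain_in r (Poly_Mapping.keys (lead_monom f))"
      using gd_lead_has_chain[OF assms(1) fls_const_hom infinite_fls assms(3)] f
      unfolding N_def V_def W_def by blast
    then obtain R C where ch: "is_chain r R C"
      and supp: "(\<lambda>a. (R a, C a)) ` {0..<r} \<subseteq> Poly_Mapping.keys (lead_monom f)"
      by (auto simp: chain_in_def)
    obtain b where b: "lead_monom f = perm_monom r R C id + b" by (rule chain_factor[OF ch supp])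
    let ?g = "kill_vars V (gen_minor r R C) :: 'k mpoly"
    have RCV: "(\<lambda>a. (R a, C a)) ` {0..<r} \<subseteq> V" using supp leadV by blast
    have "?g \<in> minors r X"
      unfolding assms(2) V_def by (rule chain_minor_in_minors[OF ch]) (use RCV VW W_def in blast)
    moreover note lead_kill_vars_gen_minor[OF ch RCV, where 'k = 'k]
    ultimately have "mono_poly (perm_monom r R C id) \<in> ?L (minors r X)" by force
    then have "mono_poly (perm_monom r R C id) \<in> initial_ideal V (minors r X)" using ini_gen by blast
    moreover have "mono_poly b \<in> carrier (poly_ring V :: 'k mpoly ring)"
      using leadV by (auto simp: b keys_monomial_add carrier_poly_ring_iff mono_poly_def)
    ultimately have "mono_poly (perm_monom r R C id) \<otimes>\<^bsub>poly_ring V\<^esub> mono_poly b \<in> initial_ideal V (minors r X)"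
      by (rule ini.I_r_closed)
    then show "x \<in> initial_ideal V (minors r X)" by (simp add: x b mono_poly_def mult_single)
  qed
  ultimately show ?thesis
    using fin sub unfolding groebner_basis_def V_def by blast
qed

end
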